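(* Let $\mathcal{G}_1$ and $\mathcal{G}_2$ be effective ample minimal Hausdorff groupoids whose unit spaces have no isolated points. For $i=1,2$ let $\Gamma_i$ be a subgroup with $\mathsf{D}(\llbracket \mathcal{G}_i \rrbracket) \leq \Gamma_i \leq \llbracket \mathcal{G}_i \rrbracket$. If $\Gamma_1 \cong \Gamma_2$ as abstract groups, then $\mathcal{G}_1 \cong \mathcal{G}_2$ as topological groupoids. In particular, the following are equivalent: (1) $\mathcal{G}_1 \cong \mathcal{G}_2$ as topological groupoids; (2) $\llbracket \mathcal{G}_1 \rrbracket \cong \llbracket \mathcal{G}_2 \rrbracket$ as abstract groups; (3) $\mathsf{D}(\llbracket \mathcal{G}_1 \rrbracket) \cong \mathsf{D}(\llbracket \mathcal{G}_2 \rrbracket)$ as abstract groups.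
   Context: An étale groupoid is a topological groupoid $\mathcal{G}$ whose range map $r(g)=gg^{-1}$ (and hence source map $s(g)=g^{-1}g$) is a local homeomorphism; its unit space $\mathcal{G}^{(0)}$ carries the relative topology. $\mathcal{G}$ is ample if it is étale and $\mathcal{G}^{(0)}$ is Hausdorff with a basis of compact open sets. $\mathcal{G}$ is effective if the interior of the isotropy bundle $\{g \in \mathcal{G} : s(g)=r(g)\}$ equals $\mathcal{G}^{(0)}$. The $\mathcal{G}$-orbit of $x \in \mathcal{G}^{(0)}$ is $\{r(g): s(g)=x\}$; $\mathcal{G}$ is minimal if every orbit is dense in $\mathcal{G}^{(0)}$. A bisection is an open $U\subseteq \mathcal{G}$ on which $s$ and $r$ are injective; it is full if $s(U)=r(U)=\mathcal{G}^{(0)}$. For a bisection $U$, $\pi_U = r|_U\circ (s|_U)^{-1}\colon s(U)\to r(U)$. The support of a homeomorphism $\phi$ is the closure of $\{x : \phi(x)\neq x\}$. The topological full group $\llbracket \mathcal{G}\rrbracket$ is the subgroup of $\operatorname{Homeo}(\mathcal{G}^{(0)})$ consisting of all $\pi_U$ with $U$ a full bisection such that $\operatorname{supp}(\pi_U)$ is compact; $\mathsf{D}(\llbracket \mathcal{G}\rrbracket)$ denotes its commutator subgroup. An isomorphism of topological groupoids is a groupoid isomorphism that is a homeomorphism. *)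

theory Defs
  imports "HOL-Analysis.Analysis" "HOL-Algebra.Algebra"
begin

text \<open>A topological groupoid: arrows are the points of a topology; a composability
relation, a partial multiplication and an inversion (Renault's axioms).\<close>

record 'a tgpd =
  gtop  :: "'a topology"
  gcomp :: "'a \<Rightarrow> 'a \<Rightarrow> bool"
  gmul  :: "'a \<Rightarrow> 'a \<Rightarrow> 'a"
  ginv  :: "'a \<Rightarrow> 'a"

definition arrows :: "'a tgpd \<Rightarrow> 'a set" where
  "arrows G = topspace (gtop G)"

definition rng :: "'a tgpd \<Rightarrow> 'a \<Rightarrow> 'a" where
  "rng G g = gmul G g (ginv G g)"

definition src :: "'a tgpd \<Rightarrow> 'a \<Rightarrow> 'a" where
  "src G g = gmul G (ginv G g) g"

definition units :: "'a tgpd \<Rightarrow> 'a set" where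
  "units G = rng G ` arrows G"

definition unit_top :: "'a tgpd \<Rightarrow> 'a topology" where
  "unit_top G = subtopology (gtop G) (units G)"

definition groupoid :: "'a tgpd \<Rightarrow> bool" where
  "groupoid G \<longleftrightarrow>
     (\<forall>g\<in>arrows G. ginv G g \<in> arrows G \<and> ginv G (ginv G g) = g) \<and>
     (\<forall>g h. gcomp G g h \<longrightarrow> g \<in> arrows G \<and> h \<in> arrows G \<and> gmul G g h \<in> arrows G) \<and>
     (\<forall>g h k. gcomp G g h \<and> gcomp G h k \<longrightarrow>
        gcomp G (gmul G g h) k \<and> gcomp G g (gmul G h k) \<and>
        gmul G (gmul G g h) k = gmul G g (gmul G h k)) \<and>
     (\<forall>g\<in>arrows G. gcomp G (ginv G g) g) \<and>
     (\<forall>g h. gcomp G g h \<longrightarrow>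
        gmul G (ginv G g) (gmul G g h) = h \<and> gmul G (gmul G g h) (ginv G h) = g)"

definition topological_groupoid :: "'a tgpd \<Rightarrow> bool" where
  "topological_groupoid G \<longleftrightarrow> groupoid G \<and>
     continuous_map (subtopology (prod_topology (gtop G) (gtop G)) {(g, h). gcomp G g h})
                    (gtop G) (\<lambda>(g, h). gmul G g h) \<and>
     continuous_map (gtop G) (gtop G) (ginv G)"

definition local_homeomorphism :: "'a topology \<Rightarrow> 'b topology \<Rightarrow> ('a \<Rightarrow> 'b) \<Rightarrow> bool" where
  "local_homeomorphism S T f \<longleftrightarrow> f ` topspace S \<subseteq> topspace T \<and>
     (\<forall>x\<in>topspace S. \<exists>U. openin S U \<and> x \<in> U \<and> openin T (f ` U) \<and>
        homeomorphic_map (subtopology S U) (subtopology T (f ` U)) f)"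

definition etale :: "'a tgpd \<Rightarrow> bool" where
  "etale G \<longleftrightarrow> topological_groupoid G \<and> local_homeomorphism (gtop G) (unit_top G) (rng G)"

definition ample :: "'a tgpd \<Rightarrow> bool" where
  "ample G \<longleftrightarrow> etale G \<and> Hausdorff_space (unit_top G) \<and>
     (\<forall>V x. openin (unit_top G) V \<and> x \<in> V \<longrightarrow>
        (\<exists>K. openin (unit_top G) K \<and> compactin (unit_top G) K \<and> x \<in> K \<and> K \<subseteq> V))"

definition effective :: "'a tgpd \<Rightarrow> bool" where
  "effective G \<longleftrightarrow> (gtop G) interior_of {g \<in> arrows G. src G g = rng G g} = units G"

definition orbit :: "'a tgpd \<Rightarrow> 'a \<Rightarrow> 'a set" where
  "orbit G x = {rng G g | g. g \<in> arrows G \<and> src G g = x}"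

definition minimal :: "'a tgpd \<Rightarrow> bool" where
  "minimal G \<longleftrightarrow> (\<forall>x\<in>units G. (unit_top G) closure_of (orbit G x) = units G)"

definition hausdorff_groupoid :: "'a tgpd \<Rightarrow> bool" where
  "hausdorff_groupoid G \<longleftrightarrow> Hausdorff_space (gtop G)"

definition no_isolated_units :: "'a tgpd \<Rightarrow> bool" where
  "no_isolated_units G \<longleftrightarrow> (\<forall>x\<in>units G. \<not> openin (unit_top G) {x})"

definition bisection :: "'a tgpd \<Rightarrow> 'a set \<Rightarrow> bool" where
  "bisection G U \<longleftrightarrow> openin (gtop G) U \<and> inj_on (src G) U \<and> inj_on (rng G) U"

definition full_bisection :: "'a tgpd \<Rightarrow> 'a set \<Rightarrow> bool" where
  "full_bisection G U \<longleftrightarrow> bisection G U \<and> src G ` U = units G \<and> rng G ` U = units G"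

text \<open>The homeomorphism pi_U of the unit space; extended by the identity off the
unit space so that equality of functions is equality of homeomorphisms.\<close>
definition pi_bis :: "'a tgpd \<Rightarrow> 'a set \<Rightarrow> 'a \<Rightarrow> 'a" where
  "pi_bis G U = (\<lambda>x. if x \<in> units G then rng G (the_inv_into U (src G) x) else x)"

definition supp :: "'a tgpd \<Rightarrow> ('a \<Rightarrow> 'a) \<Rightarrow> 'a set" where
  "supp G \<phi> = (unit_top G) closure_of {x \<in> units G. \<phi> x \<noteq> x}"

definition tfg :: "'a tgpd \<Rightarrow> ('a \<Rightarrow> 'a) monoid" where
  "tfg G = \<lparr>carrier = {pi_bis G U | U. full_bisection G U \<and>
                         compactin (unit_top G) (supp G (pi_bis G U))},
           mult = (\<circ>), one = id\<rparr>"

definition Dtfg :: "'a tgpd \<Rightarrow> ('a \<Rightarrow> 'a) monoid" where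
  "Dtfg G = (tfg G)\<lparr>carrier := derived (tfg G) (carrier (tfg G))\<rparr>"

definition groupoid_iso_map :: "'a tgpd \<Rightarrow> 'b tgpd \<Rightarrow> ('a \<Rightarrow> 'b) \<Rightarrow> bool" where
  "groupoid_iso_map G H \<phi> \<longleftrightarrow> homeomorphic_map (gtop G) (gtop H) \<phi> \<and>
     (\<forall>g\<in>arrows G. \<forall>h\<in>arrows G. gcomp G g h \<longleftrightarrow> gcomp H (\<phi> g) (\<phi> h)) \<and>
     (\<forall>g h. gcomp G g h \<longrightarrow> \<phi> (gmul G g h) = gmul H (\<phi> g) (\<phi> h))"

definition groupoid_isomorphic :: "'a tgpd \<Rightarrow> 'b tgpd \<Rightarrow> bool" where
  "groupoid_isomorphic G H \<longleftrightarrow> (\<exists>\<phi>. groupoid_iso_map G H \<phi>)"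

end

theory Submission
  imports Defs
begin

text \<open>
  Following Rubin (in the form of Belk, Elliott and Matucci), disjointness of supports can be
  expressed inside an abstract group of homeomorphisms that moves points inside every open set.
  Hence the inclusion order on supports is a group invariant. In an effective Hausdorff ample
  groupoid these supports are compact open and form a basis of the unit space, so a point can be
  recovered from the set of supports containing it and every group isomorphism is implemented by a
  homeomorphism of the unit spaces. Minimality and the absence of isolated units let 3-cycles, which
  are commutators of involutions, realize germs of arbitrary arrows; by effectiveness an arrow is
  determined by its germ, so the spatial isomorphism extends to the groupoids.
\<close>

section \<open>Reconstructing a space from a group of homeomorphisms\<close>

text \<open>Commuting elements can have overlapping supports, as powers of one element show, so
  commutation alone does not detect disjointness. The relation \<open>perp\<close> detects it only
  after \<open>g\<close> is replaced by \<open>g ^^ 12\<close>, and the support of \<open>f\<close>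
  is then recognised through the elements commuting with all these powers. This would say nothing if
  the powers were trivial, so every open set must carry an element with an orbit longer than 12.
  Hausdorffness of the arrow space makes the unit space closed in it, and this is why supports are
  open; compactness then turns a family of supports with the finite intersection property into a
  point. Full bisections are replaced by the predicate \<open>germ f g\<close>, which speaks of one
  arrow and is compatible with products; by effectiveness the arrows satisfying it for a bijection
  \<open>f\<close> form a bisection. The 3-cycles reach only arrows with distinct ends. An isotropy
  arrow is a product of two of these, so here the subgroup has to be closed under
  composition.\<close>

text \<open>The notation \<open>inv\<close> is taken by the group inverse of HOL-Algebra.\<close>

abbreviation fun_inv :: "('a \<Rightarrow> 'b) \<Rightarrow> 'b \<Rightarrow> 'a" where
  "fun_inv f \<equiv> inv_into UNIV f"

section \<open>Bijections, moved points and commutators\<close>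

definition moved :: "('a \<Rightarrow> 'a) \<Rightarrow> 'a set" where
  "moved f = {x. f x \<noteq> x}"

definition comm :: "('a \<Rightarrow> 'a) \<Rightarrow> ('a \<Rightarrow> 'a) \<Rightarrow> 'a \<Rightarrow> 'a" where
  "comm f g = f \<circ> g \<circ> fun_inv f \<circ> fun_inv g"

lemma bij_inv_simps:
  assumes "bij f"
  shows "fun_inv f (f x) = x" "f (fun_inv f x) = x" "f x = f y \<longleftrightarrow> x = y"
  using assms by (simp_all add: bij_is_inj bij_is_surj surj_f_inv_f inj_eq)

lemma not_moved: "x \<notin> moved f \<longleftrightarrow> f x = x"
  by (simp add: moved_def)

lemma not_id_if_moves: "f x \<noteq> x \<Longrightarrow> f \<noteq> id"
  by auto

lemma moved_empty_iff: "moved f = {} \<longleftrightarrow> f = id"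
  by (auto simp: moved_def)

lemma moved_comp: "moved (f \<circ> g) \<subseteq> moved f \<union> moved g"
  by (auto simp: moved_def)

lemma moved_inv: "bij f \<Longrightarrow> moved (fun_inv f) = moved f"
  unfolding moved_def by (metis bij_inv_simps(1,2))

lemma moved_conj: "bij (k :: 'a \<Rightarrow> 'a) \<Longrightarrow> moved (k \<circ> f \<circ> fun_inv k) = k ` moved f"
proof (intro subset_antisym subsetI)
  fix x assume "bij k" "x \<in> moved (k \<circ> f \<circ> fun_inv k)"
  then have "x = k (fun_inv k x)" "fun_inv k x \<in> moved f"
    by (auto simp: moved_def bij_inv_simps(2)[of k])
  then show "x \<in> k ` moved f" by blast
next
  fix x assume "bij k" "x \<in> k ` moved f"
  then show "x \<in> moved (k \<circ> f \<circ> fun_inv k)"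
    by (auto simp: moved_def bij_inv_simps[of k])
qed

text \<open>An injective map preserves its own set of moved points, and by disjointness the other
  map fixes that set pointwise.\<close>

lemma commute_if_moved_disjoint:
  assumes "bij f" "bij g" "moved f \<inter> moved g = {}"
  shows "f \<circ> g = g \<circ> f"
proof
  fix x
  note inj = bij_inv_simps(3)[OF assms(1)] bij_inv_simps(3)[OF assms(2)]
  have d: "f y = y \<or> g y = y" for y
    using assms(3) by (auto simp: moved_def)
  show "(f \<circ> g) x = (g \<circ> f) x"
  proof (cases "f x = x")
    case True
    then have "f (g x) = g x" if "g x \<noteq> x"
      using d[of "g x"] that by (simp add: inj)
    then show ?thesis using True by fastforce
  next
    case False
    then have "g x = x" "g (f x) = f x"
      using d[of x] d[of "f x"] by (simp_all add: inj)
    then show ?thesis by simp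
  qed
qed

text \<open>If \<open>k\<close> commuted with \<open>f\<close>, it would map \<open>moved f\<close>
  into itself, but \<open>k\<close> pushes \<open>V\<close> off itself.\<close>

lemma no_commute_if_displaced:
  assumes "bij k" "f \<noteq> id" "moved f \<subseteq> V" "V \<inter> k ` V = {}"
  shows "k \<circ> f \<noteq> f \<circ> k"
proof
  assume eq: "k \<circ> f = f \<circ> k"
  obtain x where x: "f x \<noteq> x"
    using assms(2) by (auto simp: fun_eq_iff)
  have "k (f x) = f (k x)" "k (f x) \<noteq> k x"
    using fun_cong[OF eq, of x] x assms(1) by (auto simp: bij_def inj_eq)
  then have "k x \<in> V" "x \<in> V"
    using x assms(3) by (auto simp: moved_def)
  then show False
    using assms(4) by auto
qed

lemma comm_conj: "comm f g = (f \<circ> g \<circ> fun_inv f) \<circ> fun_inv g"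
  by (simp add: comm_def comp_assoc)

lemma comm_eq_id_iff:
  assumes "bij f" "bij g"
  shows "comm f g = id \<longleftrightarrow> f \<circ> g = g \<circ> f"
proof
  assume a: "comm f g = id"
  show "f \<circ> g = g \<circ> f"
  proof
    fix x
    show "(f \<circ> g) x = (g \<circ> f) x"
      using fun_cong[OF a, of "g (f x)"] assms by (simp add: comm_def bij_inv_simps)
  qed
next
  assume a: "f \<circ> g = g \<circ> f"
  show "comm f g = id"
  proof
    fix x
    show "comm f g x = id x"
      using fun_cong[OF a, of "fun_inv f (fun_inv g x)"] assms by (simp add: comm_def bij_inv_simps)
  qed
qed

text \<open>Reading the commutator as a conjugate of \<open>g\<close> times \<open>fun_inv g\<close>
  gives a bound in which \<open>moved f\<close> does not occur. Applied twice, it confines a double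
  commutator to four translates of the support of its innermost entry.\<close>

lemma moved_comm:
  assumes "bij f" "bij g"
  shows "moved (comm f g) \<subseteq> f ` moved g \<union> moved g"
  using moved_comp[of "f \<circ> g \<circ> fun_inv f" "fun_inv g"] assms
  by (simp add: comm_conj moved_conj moved_inv)

lemma moved_funpow: "moved (f ^^ n) \<subseteq> moved f"
proof (induction n)
  case (Suc n)
  then show ?case using moved_comp[of f "f ^^ n"] unfolding funpow.simps by blast
qed (simp add: moved_def)

lemma funpow_commute_conv:
  assumes "f \<circ> g = g \<circ> f"
  shows "f ((g ^^ n) x) = (g ^^ n) (f x)"
  using assms by (induction n) (auto simp: fun_eq_iff)

text \<open>For mutually inverse maps, preimages under one are images under the other. In both later
  uses it is the image of a basic open set that can be computed.\<close>

lemma homeomorphic_maps_if_open: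
  assumes f: "\<And>x. x \<in> topspace A \<Longrightarrow> f x \<in> topspace B \<and> g (f x) = x"
    and g: "\<And>y. y \<in> topspace B \<Longrightarrow> g y \<in> topspace A \<and> f (g y) = y"
    and fo: "\<And>V. openin A V \<Longrightarrow> openin B (f ` V)"
    and go: "\<And>V. openin B V \<Longrightarrow> openin A (g ` V)"
  shows "homeomorphic_maps A B f g"
  unfolding homeomorphic_maps_def continuous_map_def
proof (intro conjI allI impI ballI)
  fix U assume U: "openin B U"
  have "{x \<in> topspace A. f x \<in> U} = g ` U"
  proof (intro subset_antisym subsetI)
    fix x assume "x \<in> {x \<in> topspace A. f x \<in> U}"
    then have "x = g (f x)" "f x \<in> U" using f by auto
    then show "x \<in> g ` U" by blast
  qed (use g openin_subset[OF U] in auto)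
  then show "openin A {x \<in> topspace A. f x \<in> U}" using go[OF U] by simp
next
  fix U assume U: "openin A U"
  have "{y \<in> topspace B. g y \<in> U} = f ` U"
  proof (intro subset_antisym subsetI)
    fix y assume "y \<in> {y \<in> topspace B. g y \<in> U}"
    then have "y = f (g y)" "g y \<in> U" using g by auto
    then show "y \<in> f ` U" by blast
  qed (use f openin_subset[OF U] in auto)
  then show "openin B {y \<in> topspace B. g y \<in> U}" using fo[OF U] by simp
qed (use f g in auto)

section \<open>Supports and their inclusion in group-theoretic terms\<close>

text \<open>The elements are bijections of the whole type that fix everything outside the space, so
  equality of functions is equality of homeomorphisms. The axiom \<open>move\<close> is a pointed
  form of Rubin's condition that the group be locally moving.\<close>

locale homeo_group =
  fixes Y :: "'a topology" and Gam :: "('a \<Rightarrow> 'a) set"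
  assumes haus: "Hausdorff_space Y"
    and id_in: "id \<in> Gam"
    and comp_in: "f \<in> Gam \<Longrightarrow> g \<in> Gam \<Longrightarrow> f \<circ> g \<in> Gam"
    and inv_in: "f \<in> Gam \<Longrightarrow> fun_inv f \<in> Gam"
    and bij_in: "f \<in> Gam \<Longrightarrow> bij f"
    and open_image: "f \<in> Gam \<Longrightarrow> openin Y V \<Longrightarrow> openin Y (f ` V)"
    and moved_top: "f \<in> Gam \<Longrightarrow> moved f \<subseteq> topspace Y"
    and move: "openin Y V \<Longrightarrow> x \<in> V \<Longrightarrow> \<exists>f\<in>Gam. f x \<noteq> x \<and> Y closure_of moved f \<subseteq> V"
    and sp_open: "f \<in> Gam \<Longrightarrow> openin Y (Y closure_of moved f)"
    and sp_compact: "f \<in> Gam \<Longrightarrow> compactin Y (Y closure_of moved f)"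
begin

definition sp :: "('a \<Rightarrow> 'a) \<Rightarrow> 'a set" where
  "sp f = Y closure_of moved f"

text \<open>Belk, Elliott and Matucci's algebraic disjointness. It is weaker than disjointness of supports,
  but it forces the supports of \<open>f\<close> and \<open>g ^^ 12\<close> to be disjoint: the exponent is
  \<open>lcm {1..4}\<close>, so that a point moved by \<open>g ^^ 12\<close> has at least five translates under \<open>g\<close>, whereas
  \<open>comm f1 (comm f2 h)\<close> lives on four translates of the support of \<open>h\<close>.\<close>

definition perp :: "('a \<Rightarrow> 'a) \<Rightarrow> ('a \<Rightarrow> 'a) \<Rightarrow> bool" where
  "perp f g \<longleftrightarrow> (\<forall>h\<in>Gam. f \<circ> h \<noteq> h \<circ> f \<longrightarrow> (\<exists>f1\<in>Gam. \<exists>f2\<in>Gam.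
      f1 \<circ> g = g \<circ> f1 \<and> f2 \<circ> g = g \<circ> f2 \<and>
      comm f1 (comm f2 h) \<noteq> id \<and> comm f1 (comm f2 h) \<circ> g = g \<circ> comm f1 (comm f2 h)))"

lemma comm_in: "f \<in> Gam \<Longrightarrow> g \<in> Gam \<Longrightarrow> comm f g \<in> Gam"
  by (simp add: comm_def comp_in inv_in)

lemma funpow_in: "f \<in> Gam \<Longrightarrow> f ^^ n \<in> Gam"
  by (induction n) (auto simp: id_in comp_in id_def[symmetric])

lemma moved_sp: "f \<in> Gam \<Longrightarrow> moved f \<subseteq> sp f"
  unfolding sp_def by (rule closure_of_subset[OF moved_top])

lemma move': "openin Y V \<Longrightarrow> x \<in> V \<Longrightarrow> \<exists>f\<in>Gam. f x \<noteq> x \<and> moved f \<subseteq> V"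
  using move[of V x] moved_sp unfolding sp_def by blast

lemma map_top: "f \<in> Gam \<Longrightarrow> x \<in> topspace Y \<Longrightarrow> f x \<in> topspace Y"
  using open_image[OF _ openin_topspace] openin_subset by blast

lemma displaced_nbhd1:
  assumes "f \<in> Gam" "f x \<noteq> x"
  shows "\<exists>V. openin Y V \<and> x \<in> V \<and> V \<inter> f ` V = {}"
proof -
  have x: "x \<in> topspace Y"
    using assms moved_top by (auto simp: moved_def)
  obtain A B where AB: "openin Y A" "openin Y B" "x \<in> A" "f x \<in> B" "disjnt A B"
    using haus x map_top[OF assms(1) x] assms(2) unfolding Hausdorff_space_def by metis
  have b: "bij f" by (rule bij_in[OF assms(1)])
  have "openin Y (A \<inter> fun_inv f ` B)"
    using AB open_image[OF inv_in[OF assms(1)]] by blast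
  moreover have "x \<in> A \<inter> fun_inv f ` B"
    using AB b by (auto simp: image_iff bij_is_inj intro!: bexI[of _ "f x"])
  moreover have "f ` (A \<inter> fun_inv f ` B) \<subseteq> B"
    using b by (auto simp: bij_is_surj surj_f_inv_f)
  ultimately show ?thesis
    using AB(5) unfolding disjnt_def by blast
qed

lemma displaced_nbhd:
  assumes "finite F" "F \<subseteq> Gam" "\<And>f. f \<in> F \<Longrightarrow> f x \<noteq> x" "openin Y U" "x \<in> U"
  shows "\<exists>V. openin Y V \<and> x \<in> V \<and> V \<subseteq> U \<and> (\<forall>f\<in>F. V \<inter> f ` V = {})"
  using assms
proof (induction F)
  case (insert f F)
  then obtain V where V: "openin Y V" "x \<in> V" "V \<subseteq> U" "\<forall>f\<in>F. V \<inter> f ` V = {}"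
    by auto
  obtain W where W: "openin Y W" "x \<in> W" "W \<inter> f ` W = {}"
    using displaced_nbhd1[of f x] insert.prems by auto
  show ?case
    using V W by (intro exI[of _ "V \<inter> W"]) blast
qed auto

text \<open>Induction on \<open>n\<close>. Take \<open>W\<close> around \<open>x\<close> disjoint
  from its first \<open>n\<close> translates under \<open>g\<close>. Either some point of
  \<open>W\<close> already survives one more step, or \<open>g ^^ Suc n\<close> is the identity on
  \<open>W\<close>. In the second case compose \<open>g\<close> with a \<open>k\<close> that moves
  \<open>x\<close> inside \<open>W\<close>: the orbit of \<open>x\<close> leaves \<open>W\<close>
  after one step and stays outside through time \<open>n\<close>, so \<open>k\<close> acts only once
  and \<open>Suc n\<close> steps lead to \<open>k x\<close>, not to \<open>x\<close>.\<close>

lemma long_orbit: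
  assumes "openin Y V" "V \<noteq> {}"
  shows "\<exists>g\<in>Gam. moved g \<subseteq> V \<and> (\<exists>x\<in>V. \<forall>i\<in>{1..n}. (g ^^ i) x \<noteq> x)"
proof (induction n)
  case 0
  then show ?case using assms id_in by (auto intro!: bexI[of _ id] simp: moved_def)
next
  case (Suc n)
  then obtain g x where g: "g \<in> Gam" "moved g \<subseteq> V" "x \<in> V" "\<And>i. i \<in> {1..n} \<Longrightarrow> (g ^^ i) x \<noteq> x"
    by blast
  obtain W where W: "openin Y W" "x \<in> W" "W \<subseteq> V" "\<forall>f\<in>(\<lambda>i. g ^^ i) ` {1..n}. W \<inter> f ` W = {}"
    proof (rule exE[OF displaced_nbhd[of "(\<lambda>i. g ^^ i) ` {1..n}" x V]])
    show "f x \<noteq> x" if "f \<in> (\<lambda>i. g ^^ i) ` {1..n}" for f using that g(4) by blast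
  qed (use g(1,3) assms(1) funpow_in in auto)
  have W': "(g ^^ i) y \<notin> W" if "y \<in> W" "i \<in> {1..n}" for i y
    using W(4) that by blast
  show ?case
  proof (cases "\<exists>y\<in>W. (g ^^ Suc n) y \<noteq> y")
    case True
    then obtain y where y: "y \<in> W" "(g ^^ Suc n) y \<noteq> y" by blast
    have "(g ^^ i) y \<noteq> y" if "i \<in> {1..Suc n}" for i
      using that y W'[of y i] by (cases "i = Suc n") auto
    then show ?thesis
      using g W(3) y(1) by blast
  next
    case False
    obtain k where k: "k \<in> Gam" "k x \<noteq> x" "moved k \<subseteq> W"
      using move'[OF W(1,2)] by blast
    have kW: "k y = y" if "y \<notin> W" for y
      using that k(3) by (auto simp: moved_def)
    have kx: "k x \<in> W"
      using k(2) kW[of "k x"] bij_inv_simps(3)[OF bij_in[OF k(1)]] by blast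
    have pw: "((g \<circ> k) ^^ i) x = (g ^^ i) (k x)" if "i \<in> {1..Suc n}" for i
      using that
    proof (induction i)
      case (Suc i)
      show ?case
      proof (cases "i = 0")
        case False
        then have "i \<in> {1..n}" using Suc.prems by auto
        then show ?thesis
          using Suc.IH kW[OF W'[OF kx, of i]] by auto
      qed simp
    qed simp
    have "((g \<circ> k) ^^ i) x \<noteq> x" if "i \<in> {1..Suc n}" for i
    proof (cases "i = Suc n")
      case True
      then show ?thesis using pw[OF that] False kx k(2) by auto
    next
      case False
      then show ?thesis using pw[OF that] W'[OF kx, of i] that W(2) by auto
    qed
    moreover have "moved (g \<circ> k) \<subseteq> V"
      using moved_comp[of g k] g(2) k(3) W(3) by blast
    ultimately show ?thesis
      using g k comp_in by blast
  qed
qed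

text \<open>Any \<open>h\<close> that does not commute with \<open>f\<close> moves some point of
  \<open>moved f\<close>. Choose \<open>f1\<close> and \<open>f2\<close> without common commutation
  inside a small \<open>V\<close> displaced by \<open>h\<close>. Then \<open>comm f2 h\<close> is
  \<open>f2\<close> times an element living on the translate of \<open>V\<close> under
  \<open>h\<close>, which \<open>f1\<close> does not see, so the double commutator collapses to
  \<open>comm f1 f2\<close>. It is nontrivial and lives inside \<open>moved f\<close>, away from
  \<open>g\<close>.\<close>

lemma perp_if_disjoint:
  assumes f: "f \<in> Gam" and g: "g \<in> Gam" and d: "moved f \<inter> moved g = {}" and o: "openin Y (moved f)"
  shows "perp f g"
  unfolding perp_def
proof (intro ballI impI)
  fix h assume h: "h \<in> Gam" and "f \<circ> h \<noteq> h \<circ> f"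
  then have "moved f \<inter> moved h \<noteq> {}"
    using commute_if_moved_disjoint[of f h] bij_in f by blast
  then obtain x where x: "x \<in> moved f" "h x \<noteq> x"
    by (auto simp: moved_def)
  obtain V where V: "openin Y V" "x \<in> V" "V \<subseteq> moved f" "V \<inter> h ` V = {}"
    using displaced_nbhd[of "{h}" x "moved f"] h x o by auto
  obtain f2 where f2: "f2 \<in> Gam" "f2 x \<noteq> x" "moved f2 \<subseteq> V"
    using move'[OF V(1,2)] by blast
  obtain W where W: "openin Y W" "x \<in> W" "W \<subseteq> V" "W \<inter> f2 ` W = {}"
    using displaced_nbhd[of "{f2}" x V] f2 V by auto
  obtain f1 where f1: "f1 \<in> Gam" "f1 x \<noteq> x" "moved f1 \<subseteq> W"
    using move'[OF W(1,2)] by blast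
  have b: "bij f1" "bij f2" "bij h" "bij g"
    using f1 f2 h g bij_in by auto
  have nc: "f2 \<circ> f1 \<noteq> f1 \<circ> f2"
    using no_commute_if_displaced[OF b(2) not_id_if_moves[of f1 x, OF f1(2)] f1(3) W(4)] .
  have m1: "moved f1 \<subseteq> V" using f1 W by blast
  define q where "q = h \<circ> fun_inv f2 \<circ> fun_inv h"
  have bq: "bij q" unfolding q_def using b by (simp add: bij_comp bij_imp_bij_inv)
  have mq: "moved q \<subseteq> h ` V"
    unfolding q_def using moved_conj[OF b(3), of "fun_inv f2"] moved_inv[OF b(2)] f2(3) by auto
  have c2: "comm f2 h = f2 \<circ> q"
    by (simp add: comm_def q_def comp_assoc)
  have "f1 \<circ> q = q \<circ> f1"
    using commute_if_moved_disjoint[OF b(1) bq] m1 mq V(4) by blast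
  moreover have b12: "bij (f2 \<circ> q)" using b bq by (simp add: bij_comp)
  ultimately have k: "comm f1 (comm f2 h) = comm f1 f2"
  proof -
    assume a: "f1 \<circ> q = q \<circ> f1" 
    have "q (fun_inv f1 y) = fun_inv f1 (q y)" for y
      using fun_cong[OF a, of "fun_inv f1 y"] bij_inv_simps[OF b(1)] by (metis comp_apply)
    then show ?thesis
      unfolding c2 unfolding comm_def using b bq
      by (simp add: fun_eq_iff o_inv_distrib bij_inv_simps)
  qed
  have "comm f1 f2 \<noteq> id"
    using comm_eq_id_iff[OF b(1,2)] nc by auto
  moreover have mk: "moved (comm f1 f2) \<subseteq> V"
  proof -
    have "moved (f1 \<circ> f2 \<circ> fun_inv f1 \<circ> fun_inv f2) \<subseteq> moved f1 \<union> moved f2 \<union> moved (fun_inv f1) \<union> moved (fun_inv f2)"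
      unfolding moved_def by auto
    then show ?thesis
      using m1 f2(3) moved_inv[OF b(1)] moved_inv[OF b(2)] unfolding comm_def by blast
  qed
  moreover have cg: "p \<circ> g = g \<circ> p" if "bij p" "moved p \<subseteq> V" for p
    using commute_if_moved_disjoint[OF that(1) b(4)] that(2) V(3) d by blast
  moreover have "bij (comm f1 f2)"
    using bij_in comm_in f1 f2 by blast
  ultimately show "\<exists>f1\<in>Gam. \<exists>f2\<in>Gam. f1 \<circ> g = g \<circ> f1 \<and> f2 \<circ> g = g \<circ> f2 \<and>
      comm f1 (comm f2 h) \<noteq> id \<and> comm f1 (comm f2 h) \<circ> g = g \<circ> comm f1 (comm f2 h)"
    by (intro bexI[OF _ f1(1)] bexI[OF _ f2(1)]) (simp only: k cg[OF b(1) m1] cg[OF b(2) f2(3)], simp)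
qed

text \<open>At a point moved by both maps, pick \<open>V\<close> displaced by \<open>f\<close> and
  by the first four powers of \<open>g\<close>, and \<open>h\<close> inside \<open>V\<close>. The
  double commutator supplied by \<open>perp\<close> commutes with \<open>g\<close>, so its moved set
  is invariant under \<open>g\<close>, yet it is covered by four translates of \<open>V\<close>. Two
  of five consecutive orbit points share a translate, and since the translating map is injective and
  commutes with \<open>g\<close>, a power of \<open>g\<close> that displaces \<open>V\<close> sends
  a point of \<open>V\<close> into \<open>V\<close>.\<close>

lemma disjoint_if_perp:
  assumes f: "f \<in> Gam" and g: "g \<in> Gam" and p: "perp f g"
  shows "moved f \<inter> moved (g ^^ 12) = {}"
proof (rule ccontr)
  assume "moved f \<inter> moved (g ^^ 12) \<noteq> {}"
  then obtain x where x: "f x \<noteq> x" "(g ^^ 12) x \<noteq> x"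
    by (auto simp: moved_def)
  have div12: "(g ^^ i) x \<noteq> x" if "i dvd 12" for i
  proof
    assume a: "(g ^^ i) x = x"
    have "((g ^^ i) ^^ j) x = x" for j by (induction j) (auto simp: a)
    then show False using x(2) that by (metis dvd_def funpow_mult mult.commute)
  qed
  have gi: "(g ^^ i) x \<noteq> x" if "i \<in> {1..4}" for i
  proof -
    have "i \<in> {1,2,3,4}" using that by auto
    then show ?thesis using div12[of i] by auto
  qed
  have xt: "x \<in> topspace Y" using moved_top[OF f] x by (auto simp: moved_def)
  obtain V where V: "openin Y V" "x \<in> V" "\<forall>k\<in>insert f ((\<lambda>i. g ^^ i) ` {1..4}). V \<inter> k ` V = {}"
  proof (rule exE[OF displaced_nbhd[of "insert f ((\<lambda>i. g ^^ i) ` {1..4})" x "topspace Y"]])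
    show "k x \<noteq> x" if "k \<in> insert f ((\<lambda>i. g ^^ i) ` {1..4})" for k using that gi x(1) by blast
  qed (use f xt funpow_in[OF g] in auto)
  obtain h where h: "h \<in> Gam" "h x \<noteq> x" "moved h \<subseteq> V"
    using move'[OF V(1,2)] by blast
  have "f \<circ> h \<noteq> h \<circ> f"
    using no_commute_if_displaced[OF bij_in[OF f] not_id_if_moves[of h x] h(3)] h(2) V(3) by blast
  then obtain f1 f2 where f12: "f1 \<in> Gam" "f2 \<in> Gam" "f1 \<circ> g = g \<circ> f1" "f2 \<circ> g = g \<circ> f2"
      "comm f1 (comm f2 h) \<noteq> id" "comm f1 (comm f2 h) \<circ> g = g \<circ> comm f1 (comm f2 h)"
    using p h(1) unfolding perp_def by blast
  define k where "k = comm f1 (comm f2 h)"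
  \<comment> \<open>The four translating maps that arise when \<open>moved_comm\<close> is used for
    the inner and then for the outer commutator.\<close>
  define P where "P = (\<lambda>j::nat. [id, f1, f2, f1 \<circ> f2] ! j)"
  have b: "bij f1" "bij f2" "bij h" "bij (comm f2 h)" "bij g"
    using f12 h g bij_in comm_in by auto
  have less4: "{..<4::nat} = {0, 1, 2, 3}" by auto
  have P: "P 0 = id" "P 1 = f1" "P 2 = f2" "P 3 = f1 \<circ> f2"
    by (simp_all add: P_def eval_nat_numeral)
  have Pcases: "P j = id \<or> P j = f1 \<or> P j = f2 \<or> P j = f1 \<circ> f2" if "j < 4" for j
  proof -
    have "j = 0 \<or> j = 1 \<or> j = 2 \<or> j = 3" using that by arith
    then show ?thesis using P by metis
  qed
  have Pg: "P j ((g ^^ n) y) = (g ^^ n) (P j y)" if "j < 4" for j n y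
    using Pcases[OF that]
    by (elim disjE) (simp_all add: funpow_commute_conv[OF f12(3)] funpow_commute_conv[OF f12(4)])
  have Pinj: "inj (P j)" if "j < 4" for j
    using Pcases[OF that] by (elim disjE) (simp_all add: b bij_is_inj inj_compose)
  have c: "moved (comm f2 h) \<subseteq> f2 ` V \<union> V"
    by (rule order_trans[OF moved_comm[OF b(2,3)] Un_mono[OF image_mono[OF h(3)] h(3)]])
  have "moved k \<subseteq> f1 ` moved (comm f2 h) \<union> moved (comm f2 h)"
    unfolding k_def by (rule moved_comm[OF b(1,4)])
  also have "f1 ` moved (comm f2 h) \<union> moved (comm f2 h) \<subseteq> f1 ` (f2 ` V \<union> V) \<union> (f2 ` V \<union> V)"
    by (rule Un_mono[OF image_mono[OF c] c])
  also have "\<dots> = (\<Union>j<4. P j ` V)"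
    by (simp only: less4 UN_insert UN_empty P image_comp image_id image_Un Un_ac Un_empty_left Un_empty_right id_apply)
  finally have cover: "moved k \<subseteq> (\<Union>j<4. P j ` V)" .
  obtain y where y: "y \<in> moved k"
    using f12(5) moved_empty_iff[of k] unfolding k_def by blast
  have "(g ^^ n) y \<in> moved k" for n
  proof -
    have "k ((g ^^ n) y) = (g ^^ n) (k y)"
      by (rule funpow_commute_conv) (use f12(6) k_def in simp)
    moreover have "inj (g ^^ n)" using bij_in funpow_in[OF g] by (auto simp: bij_is_inj)
    ultimately show ?thesis using y by (auto simp: moved_def inj_eq)
  qed
  then have "\<exists>j. j < 4 \<and> (g ^^ n) y \<in> P j ` V" for n
    using cover by fastforce
  then obtain J where J: "\<And>n. J n < 4 \<and> (g ^^ n) y \<in> P (J n) ` V"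
    by metis
  \<comment> \<open>Pigeonhole: five times \<open>0\<close> to \<open>4\<close>, four
    translates.\<close>
  have "\<not> inj_on J {0..4::nat}"
  proof
    assume "inj_on J {0..4::nat}"
    then have "card {0..4::nat} \<le> card {..<4::nat}"
      by (rule card_inj_on_le) (use J in auto)
    then show False by simp
  qed
  then obtain m n where mn: "m < n" "n \<le> 4" "J m = J n"
    unfolding inj_on_def by (metis atLeastAtMost_iff linorder_neqE_nat)
  obtain z z' where z: "z \<in> V" "(g ^^ m) y = P (J m) z" "z' \<in> V" "(g ^^ n) y = P (J m) z'"
    using J[of m] J[of n] mn by auto
  have "P (J m) ((g ^^ (n - m)) z) = (g ^^ (n - m)) ((g ^^ m) y)"
    using Pg J z by simp
  also have "\<dots> = (g ^^ n) y"
    using mn(1) by (metis comp_apply funpow_add le_add_diff_inverse2 less_imp_le)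
  finally have "(g ^^ (n - m)) z = z'"
    using z(4) Pinj J by (simp add: inj_eq)
  then show False
    using z(1,3) V(3) mn(1,2) by (force dest!: bspec[of _ _ "g ^^ (n - m)"])
qed


lemma moved_open:
  assumes "f \<in> Gam"
  shows "openin Y (moved f)"
proof (subst openin_subopen, intro ballI)
  fix x assume "x \<in> moved f"
  then obtain V where "openin Y V" "x \<in> V" "V \<inter> f ` V = {}"
    using displaced_nbhd1[OF assms, of x] by (auto simp: moved_def)
  then show "\<exists>V. openin Y V \<and> x \<in> V \<and> V \<subseteq> moved f"
    by (intro exI[of _ V]) (force simp: moved_def image_iff)
qed

lemma sp_closed: "closedin Y (sp f)"
  by (simp add: sp_def)

text \<open>The right-hand side uses only the group structure, so isomorphisms respect inclusion of
  supports. If the inclusion fails, \<open>q\<close> displaces a small open set outside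
  \<open>sp f\<close>. That set carries some \<open>g\<close> with \<open>g ^^ 12\<close>
  nontrivial; its support misses that of \<open>f\<close>, so it satisfies \<open>perp f g\<close>,
  but \<open>q\<close> pushes the support of the power off itself and cannot commute with
  it.\<close>

theorem sp_subset_iff_commute:
  assumes f: "f \<in> Gam" and q: "q \<in> Gam"
  shows "sp q \<subseteq> sp f \<longleftrightarrow> (\<forall>g\<in>Gam. perp f g \<longrightarrow> q \<circ> (g ^^ 12) = (g ^^ 12) \<circ> q)"
proof (intro iffI ballI impI)
  fix g assume sub: "sp q \<subseteq> sp f" and g: "g \<in> Gam" and "perp f g"
  then have "moved (g ^^ 12) \<inter> moved f = {}"
    using disjoint_if_perp[OF f g] by blast
  then have "moved (g ^^ 12) \<inter> sp f = {}"
    unfolding sp_def using moved_open[OF funpow_in[OF g]]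
    by (subst openin_Int_closure_of_eq_empty)
  then have "moved q \<inter> moved (g ^^ 12) = {}"
    using sub moved_sp[OF q] by blast
  then show "q \<circ> (g ^^ 12) = (g ^^ 12) \<circ> q"
    by (intro commute_if_moved_disjoint bij_in q funpow_in g)
next
  assume comm: "\<forall>g\<in>Gam. perp f g \<longrightarrow> q \<circ> (g ^^ 12) = (g ^^ 12) \<circ> q"
  have "moved q \<subseteq> sp f"
  proof (rule ccontr)
    assume "\<not> moved q \<subseteq> sp f"
    then obtain x where x: "q x \<noteq> x" "x \<in> topspace Y - sp f"
      using moved_top[OF q] by (auto simp: moved_def)
    obtain V where V: "openin Y V" "x \<in> V" "V \<subseteq> topspace Y - sp f" "V \<inter> q ` V = {}"
      using displaced_nbhd[of "{q}" x "topspace Y - sp f"] x q sp_closed[of f] by (auto simp: closedin_def)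
    then have "V \<noteq> {}" by blast
    then obtain g y where g: "g \<in> Gam" "moved g \<subseteq> V" "\<forall>i\<in>{1..12}. (g ^^ i) y \<noteq> y"
      using long_orbit[OF V(1), of 12] by blast
    have "(12::nat) \<in> {1..12}" by simp
    then have ne: "g ^^ 12 \<noteq> id"
      using g(3) not_id_if_moves[of "g ^^ 12" y] by blast
    have "perp f g"
      using perp_if_disjoint[OF f g(1) _ moved_open[OF f]] g(2) V(3) moved_sp[OF f] by blast
    moreover have "moved (g ^^ 12) \<subseteq> V"
      using moved_funpow[of 12 g] g(2) by blast
    ultimately show False
      using no_commute_if_displaced[OF bij_in[OF q] ne _ V(4)] comm g(1) by blast
  qed
  then show "sp q \<subseteq> sp f"
    unfolding sp_def[of q] using sp_closed by (rule closure_of_minimal)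
qed

lemma sp_empty_iff:
  assumes "f \<in> Gam"
  shows "sp f = {} \<longleftrightarrow> f = id"
  unfolding sp_def closure_of_eq_empty[OF moved_top[OF assms]] moved_empty_iff ..

lemma sp_basis:
  assumes "openin Y V" "x \<in> V"
  shows "\<exists>f\<in>Gam. x \<in> sp f \<and> sp f \<subseteq> V"
proof -
  obtain f where "f \<in> Gam" "f x \<noteq> x" "sp f \<subseteq> V"
    using move[OF assms] unfolding sp_def by blast
  then show ?thesis
    using moved_sp[of f] by (auto simp: moved_def)
qed

text \<open>Supports are open, so finitely many of them around \<open>x\<close> meet in a
  neighbourhood, which contains a further support around \<open>x\<close>. This directedness yields
  the finite intersection property in \<open>same_exists\<close>.\<close>

lemma sp_basis_finite:
  assumes "finite F" "F \<subseteq> Gam" "x \<in> topspace Y" "\<And>f. f \<in> F \<Longrightarrow> x \<in> sp f"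
  shows "\<exists>k\<in>Gam. x \<in> sp k \<and> (\<forall>f\<in>F. sp k \<subseteq> sp f)"
proof -
  have "\<exists>V. openin Y V \<and> x \<in> V \<and> (\<forall>f\<in>F. V \<subseteq> sp f)"
    using assms
  proof (induction F)
    case (insert f F)
    then obtain V where V: "openin Y V" "x \<in> V" "\<forall>f\<in>F. V \<subseteq> sp f" by auto
    have "openin Y (sp f)" "x \<in> sp f"
      using insert.prems sp_open[of f] by (auto simp: sp_def)
    then show ?case
      using V by (intro exI[of _ "V \<inter> sp f"]) auto
  qed auto
  then show ?thesis
    using sp_basis by (meson order_trans)
qed

lemma sp_conj:
  assumes f: "f \<in> Gam" and k: "k \<in> Gam"
  shows "sp (k \<circ> f \<circ> fun_inv k) = k ` sp f"
proof -
  have b: "bij k" by (rule bij_in[OF k])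
  have sub: "sp (k \<circ> f \<circ> fun_inv k) \<subseteq> k ` sp f" if f: "f \<in> Gam" and k: "k \<in> Gam" for f k
  proof -
    have b: "bij k" by (rule bij_in[OF k])
    have kt: "k ` topspace Y = topspace Y"
      using map_top[OF k] map_top[OF inv_in[OF k]] bij_inv_simps(2)[OF b] by (metis image_eqI image_subsetI subset_antisym subsetI)
    have st: "sp f \<subseteq> topspace Y" using sp_closed[of f] closedin_subset by blast
    have "topspace Y - k ` sp f = k ` (topspace Y - sp f)"
      using kt image_set_diff[OF bij_is_inj[OF b], of "topspace Y" "sp f"] by simp
    moreover have "openin Y (k ` (topspace Y - sp f))"
      using sp_closed[of f] by (intro open_image[OF k]) (simp add: closedin_def)
    ultimately have "closedin Y (k ` sp f)"
      using image_mono[OF st, of k] by (simp add: closedin_def kt)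
    then show ?thesis
      unfolding sp_def[of "k \<circ> f \<circ> fun_inv k"] moved_conj[OF b]
      using moved_sp[OF f] by (intro closure_of_minimal) auto
  qed
  \<comment> \<open>Conjugating back by \<open>fun_inv k\<close> reduces this inclusion to the one
    just proved.\<close>
  moreover have "k ` sp f \<subseteq> sp (k \<circ> f \<circ> fun_inv k)"
  proof -
    have "fun_inv k \<circ> (k \<circ> f \<circ> fun_inv k) \<circ> fun_inv (fun_inv k) = f"
      using b by (simp add: fun_eq_iff bij_inv_simps[OF b] inv_inv_eq)
    then have "sp f \<subseteq> fun_inv k ` sp (k \<circ> f \<circ> fun_inv k)"
      using sub[of "k \<circ> f \<circ> fun_inv k" "fun_inv k"] f k by (simp add: comp_in inv_in)
    then show ?thesis
      using b by (force simp: bij_inv_simps(2)[OF b])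
  qed
  ultimately show ?thesis using f k by blast
qed

end

section \<open>Points as families of supports\<close>

text \<open>The inverse \<open>Psi\<close> is part of the data, which makes the setting symmetric:
  through \<open>swap\<close> every result also holds for the inverse isomorphism.\<close>

locale homeo_group_iso = A: homeo_group X1 Gam1 + B: homeo_group X2 Gam2
  for X1 :: "'a topology" and Gam1 and X2 :: "'b topology" and Gam2 +
  fixes Phi :: "('a \<Rightarrow> 'a) \<Rightarrow> 'b \<Rightarrow> 'b" and Psi :: "('b \<Rightarrow> 'b) \<Rightarrow> 'a \<Rightarrow> 'a"
  assumes Phi_in: "f \<in> Gam1 \<Longrightarrow> Phi f \<in> Gam2"
    and Psi_in: "f' \<in> Gam2 \<Longrightarrow> Psi f' \<in> Gam1"
    and Psi_Phi: "f \<in> Gam1 \<Longrightarrow> Psi (Phi f) = f"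
    and Phi_Psi: "f' \<in> Gam2 \<Longrightarrow> Phi (Psi f') = f'"
    and Phi_comp: "f \<in> Gam1 \<Longrightarrow> g \<in> Gam1 \<Longrightarrow> Phi (f \<circ> g) = Phi f \<circ> Phi g"
    and Psi_comp: "f' \<in> Gam2 \<Longrightarrow> g' \<in> Gam2 \<Longrightarrow> Psi (f' \<circ> g') = Psi f' \<circ> Psi g'"
begin

lemma swap: "homeo_group_iso X2 Gam2 X1 Gam1 Psi Phi"
  by unfold_locales (simp_all add: Phi_in Psi_in Psi_Phi Phi_Psi Phi_comp Psi_comp)

lemma Phi_id: "Phi id = id"
proof -
  have "Phi id \<circ> Phi id = Phi id"
    using Phi_comp[OF A.id_in A.id_in] by simp
  moreover have "bij (Phi id)"
    by (intro B.bij_in Phi_in A.id_in)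
  ultimately show ?thesis
    by (auto simp: fun_eq_iff bij_inv_simps(3))
qed

lemma Phi_inv:
  assumes f: "f \<in> Gam1"
  shows "Phi (fun_inv f) = fun_inv (Phi f)"
proof -
  have "f \<circ> fun_inv f = id"
    using bij_inv_simps(2)[OF A.bij_in[OF f]] by auto
  then have "Phi f \<circ> Phi (fun_inv f) = id"
    using Phi_comp[OF f A.inv_in[OF f]] Phi_id by simp
  then show ?thesis
    using bij_inv_simps(1)[OF B.bij_in[OF Phi_in[OF f]]] by (metis comp_apply eq_id_iff ext)
qed

lemma Phi_inj: "f \<in> Gam1 \<Longrightarrow> g \<in> Gam1 \<Longrightarrow> Phi f = Phi g \<longleftrightarrow> f = g"
  by (metis Psi_Phi)

lemma Phi_comm: "f \<in> Gam1 \<Longrightarrow> g \<in> Gam1 \<Longrightarrow> Phi (comm f g) = comm (Phi f) (Phi g)"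
  by (simp add: comm_def Phi_comp Phi_inv A.comp_in A.inv_in)

lemma Phi_funpow: "f \<in> Gam1 \<Longrightarrow> Phi (f ^^ n) = Phi f ^^ n"
  by (induction n) (simp_all add: Phi_id[unfolded id_def] id_def[symmetric] Phi_comp Phi_id A.funpow_in)

lemma commute_iff: "f \<in> Gam1 \<Longrightarrow> g \<in> Gam1 \<Longrightarrow> Phi f \<circ> Phi g = Phi g \<circ> Phi f \<longleftrightarrow> f \<circ> g = g \<circ> f"
  by (metis Phi_comp Phi_inj A.comp_in)

lemma perp_Phi:
  assumes f: "f \<in> Gam1" and g: "g \<in> Gam1" and p: "A.perp f g"
  shows "B.perp (Phi f) (Phi g)"
  unfolding B.perp_def
proof (intro ballI impI)
  fix h' assume h': "h' \<in> Gam2" and nc: "Phi f \<circ> h' \<noteq> h' \<circ> Phi f"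
  define h where "h = Psi h'"
  have h: "h \<in> Gam1" "Phi h = h'"
    using h' by (simp_all add: h_def Psi_in Phi_Psi)
  then have "f \<circ> h \<noteq> h \<circ> f"
    using nc commute_iff[OF f h(1)] by simp
  then obtain f1 f2 where f12: "f1 \<in> Gam1" "f2 \<in> Gam1" "f1 \<circ> g = g \<circ> f1" "f2 \<circ> g = g \<circ> f2"
      "comm f1 (comm f2 h) \<noteq> id" "comm f1 (comm f2 h) \<circ> g = g \<circ> comm f1 (comm f2 h)"
    using p h(1) unfolding A.perp_def by blast
  define k where "k = comm f1 (comm f2 h)"
  have k: "k \<in> Gam1" "Phi k = comm (Phi f1) (comm (Phi f2) h')"
    using f12(1,2) h by (simp_all add: k_def A.comm_in Phi_comm)
  have "Phi k \<noteq> id"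
    using f12(5) Phi_inj[OF k(1) A.id_in] Phi_id k_def by simp
  then show "\<exists>f1\<in>Gam2. \<exists>f2\<in>Gam2. f1 \<circ> Phi g = Phi g \<circ> f1 \<and> f2 \<circ> Phi g = Phi g \<circ> f2 \<and>
      comm f1 (comm f2 h') \<noteq> id \<and> comm f1 (comm f2 h') \<circ> Phi g = Phi g \<circ> comm f1 (comm f2 h')"
    using f12 k commute_iff g Phi_in k_def
    by (intro bexI[of _ "Phi f1"] bexI[of _ "Phi f2"]) (simp_all add: k(2)[symmetric])
qed

lemma perp_Phi_iff:
  assumes f: "f \<in> Gam1" and g: "g \<in> Gam1"
  shows "B.perp (Phi f) (Phi g) \<longleftrightarrow> A.perp f g"
  using perp_Phi[OF f g] homeo_group_iso.perp_Phi[OF swap Phi_in[OF f] Phi_in[OF g]]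
  by (auto simp: Psi_Phi f g)

lemma sp_Phi_subset_iff:
  assumes f: "f \<in> Gam1" and q: "q \<in> Gam1"
  shows "B.sp (Phi q) \<subseteq> B.sp (Phi f) \<longleftrightarrow> A.sp q \<subseteq> A.sp f"
proof -
  have "(\<forall>g\<in>Gam2. B.perp (Phi f) g \<longrightarrow> Phi q \<circ> (g ^^ 12) = (g ^^ 12) \<circ> Phi q) \<longleftrightarrow>
        (\<forall>g\<in>Gam1. B.perp (Phi f) (Phi g) \<longrightarrow> Phi q \<circ> (Phi g ^^ 12) = (Phi g ^^ 12) \<circ> Phi q)"
    by (metis Phi_in Psi_in Phi_Psi)
  also have "\<dots> \<longleftrightarrow> (\<forall>g\<in>Gam1. A.perp f g \<longrightarrow> q \<circ> (g ^^ 12) = (g ^^ 12) \<circ> q)"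
    by (intro ball_cong refl) (simp add: perp_Phi_iff f q Phi_funpow[symmetric] commute_iff A.funpow_in)
  finally show ?thesis
    by (simp add: A.sp_subset_iff_commute B.sp_subset_iff_commute f q Phi_in)
qed

text \<open>Disjointness reduces to inclusion because supports form a basis: two image supports that
  meet would both contain the support of a nontrivial element, and pulling it back contradicts
  disjointness.\<close>

lemma sp_Phi_disjoint:
  assumes f: "f \<in> Gam1" and g: "g \<in> Gam1" and d: "A.sp f \<inter> A.sp g = {}"
  shows "B.sp (Phi f) \<inter> B.sp (Phi g) = {}"
proof (rule ccontr)
  assume "B.sp (Phi f) \<inter> B.sp (Phi g) \<noteq> {}"
  moreover have "openin X2 (B.sp (Phi f) \<inter> B.sp (Phi g))"
    unfolding B.sp_def by (intro openin_Int B.sp_open Phi_in f g)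
  ultimately obtain k where k: "k \<in> Gam2" "B.sp k \<noteq> {}" "B.sp k \<subseteq> B.sp (Phi f) \<inter> B.sp (Phi g)"
    using B.sp_basis by blast
  then have "A.sp (Psi k) \<subseteq> A.sp f \<inter> A.sp g"
    using sp_Phi_subset_iff[OF f, of "Psi k"] sp_Phi_subset_iff[OF g, of "Psi k"] Psi_in Phi_Psi by auto
  then have "A.sp (Psi k) = {}" using d by simp
  then have "Psi k = id" using A.sp_empty_iff Psi_in k(1) by simp
  then have "k = id" using Phi_Psi[OF k(1)] Phi_id by simp
  then show False using k(1,2) B.sp_empty_iff by simp
qed

text \<open>A relation and not yet a map: the partner of a point has to be shown to exist and to be
  unique, and the relation is symmetric under \<open>swap\<close>.\<close>

definition same :: "'a \<Rightarrow> 'b \<Rightarrow> bool" where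
  "same x y \<longleftrightarrow> x \<in> topspace X1 \<and> y \<in> topspace X2 \<and> (\<forall>f\<in>Gam1. x \<in> A.sp f \<longleftrightarrow> y \<in> B.sp (Phi f))"

lemma same_swap: "homeo_group_iso.same X2 Gam2 X1 Psi y x \<longleftrightarrow> same x y"
  unfolding same_def homeo_group_iso.same_def[OF swap]
  by (metis Phi_in Psi_in Phi_Psi Psi_Phi)

lemma same_unique:
  assumes "same x y" "same x y'"
  shows "y = y'"
proof (rule ccontr)
  assume ne: "y \<noteq> y'"
  have "y \<in> topspace X2" "y' \<in> topspace X2"
    using assms by (auto simp: same_def)
  then have "openin X2 (topspace X2 - {y'})" "y \<in> topspace X2 - {y'}"
    using ne B.haus by (auto intro: open_in_Hausdorff_delete)
  then obtain k where k: "k \<in> Gam2" "y \<in> B.sp k" "y' \<notin> B.sp k"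
    using B.sp_basis by blast
  then show False
    using assms Psi_in[OF k(1)] Phi_Psi[OF k(1)] unfolding same_def by metis
qed

text \<open>By directedness, the images of the supports around \<open>x\<close> have the finite
  intersection property inside one compact support, so they share a point \<open>y\<close>. No other
  support contains \<open>y\<close>: if \<open>x\<close> is outside \<open>sp f\<close>, some
  support around \<open>x\<close> is disjoint from the closed set \<open>sp f\<close>, and the
  images of these two stay disjoint.\<close>

lemma same_exists:
  assumes x: "x \<in> topspace X1"
  shows "\<exists>y. same x y"
proof -
  define F where "F = {f \<in> Gam1. x \<in> A.sp f}"
  obtain f0 where f0: "f0 \<in> F"
    using A.sp_basis[OF openin_topspace x] by (auto simp: F_def)
  have fip: "B.sp (Phi f0) \<inter> \<Inter> ((\<lambda>f. B.sp (Phi f)) ` E) \<noteq> {}" if E: "finite E" "E \<subseteq> F" for E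
  proof -
    obtain k where k: "k \<in> Gam1" "x \<in> A.sp k" "\<forall>f\<in>insert f0 E. A.sp k \<subseteq> A.sp f"
      using A.sp_basis_finite[of "insert f0 E" x] E f0 x by (auto simp: F_def)
    have "B.sp (Phi k) \<noteq> {}"
      using k(1,2) Phi_inj[OF k(1) A.id_in] A.sp_empty_iff[OF k(1)] B.sp_empty_iff[OF Phi_in[OF k(1)]] Phi_id by auto
    moreover have "B.sp (Phi k) \<subseteq> B.sp (Phi f)" if "f \<in> insert f0 E" for f
      using that k E f0 by (subst sp_Phi_subset_iff) (auto simp: F_def)
    ultimately show ?thesis by blast
  qed
  have "B.sp (Phi f0) \<inter> \<Inter> ((\<lambda>f. B.sp (Phi f)) ` F) \<noteq> {}"
  proof -
    have cpt: "compactin X2 (B.sp (Phi f0))"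
      unfolding B.sp_def using f0 by (intro B.sp_compact Phi_in) (simp add: F_def)
    show ?thesis
    proof (rule mp[OF spec[OF conjunct2[OF cpt[unfolded compactin_fip]]]], intro conjI allI impI)
      show "\<forall>C\<in>(\<lambda>f. B.sp (Phi f)) ` F. closedin X2 C"
        using B.sp_closed by blast
      fix E' assume E': "finite E' \<and> E' \<subseteq> (\<lambda>f. B.sp (Phi f)) ` F"
      obtain E where E: "E \<subseteq> F" "finite E" "E' = (\<lambda>f. B.sp (Phi f)) ` E"
        using finite_subset_image[OF conjunct1[OF E'] conjunct2[OF E']] by blast
      show "B.sp (Phi f0) \<inter> \<Inter> E' \<noteq> {}"
        unfolding E(3) by (rule fip[OF E(2,1)])
    qed
  qed
  then obtain y where y: "\<And>f. f \<in> F \<Longrightarrow> y \<in> B.sp (Phi f)" by blast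
  have "y \<in> topspace X2"
    using y[OF f0] B.sp_closed closedin_subset by blast
  moreover have "x \<in> A.sp f" if f: "f \<in> Gam1" "y \<in> B.sp (Phi f)" for f
  proof (rule ccontr)
    assume "x \<notin> A.sp f"
    then obtain k where k: "k \<in> Gam1" "x \<in> A.sp k" "A.sp k \<subseteq> topspace X1 - A.sp f"
      using A.sp_basis[of "topspace X1 - A.sp f" x] x A.sp_closed[of f] by (auto simp: closedin_def)
    then have "B.sp (Phi k) \<inter> B.sp (Phi f) = {}"
      using f by (intro sp_Phi_disjoint) auto
    moreover have "y \<in> B.sp (Phi k)" using y k by (simp add: F_def)
    ultimately show False using f(2) by blast
  qed
  ultimately have "same x y"
    using x y unfolding same_def F_def by blast
  then show ?thesis ..
qed

text \<open>Conjugation by \<open>k\<close> translates supports by \<open>k\<close>, and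
  \<open>Phi\<close> turns it into conjugation by \<open>Phi k\<close>.\<close>

lemma same_equivariant:
  assumes k: "k \<in> Gam1" and s: "same x y"
  shows "same (k x) (Phi k y)"
  unfolding same_def
proof (intro conjI ballI)
  show "k x \<in> topspace X1" "Phi k y \<in> topspace X2"
    using s A.map_top[OF k] B.map_top[OF Phi_in[OF k]] by (auto simp: same_def)
  fix f assume f: "f \<in> Gam1"
  define g where "g = fun_inv k \<circ> f \<circ> k"
  have g: "g \<in> Gam1" by (simp add: g_def f k A.comp_in A.inv_in)
  have fg: "f = k \<circ> g \<circ> fun_inv k"
    using bij_inv_simps[OF A.bij_in[OF k]] by (simp add: g_def fun_eq_iff)
  have fg': "Phi f = Phi k \<circ> Phi g \<circ> fun_inv (Phi k)"
    by (simp add: fg Phi_comp Phi_inv g k A.comp_in A.inv_in)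
  have "k x \<in> A.sp f \<longleftrightarrow> x \<in> A.sp g"
    unfolding fg A.sp_conj[OF g k] using A.bij_in[OF k] by (simp add: bij_is_inj inj_image_mem_iff)
  moreover have "Phi k y \<in> B.sp (Phi f) \<longleftrightarrow> y \<in> B.sp (Phi g)"
    unfolding fg' B.sp_conj[OF Phi_in[OF g] Phi_in[OF k]]
    using B.bij_in[OF Phi_in[OF k]] by (simp add: bij_is_inj inj_image_mem_iff)
  ultimately show "k x \<in> A.sp f \<longleftrightarrow> Phi k y \<in> B.sp (Phi f)"
    using s g by (simp add: same_def)
qed

definition pt :: "'a \<Rightarrow> 'b" where
  "pt x = (THE y. same x y)"

lemma same_pt: "x \<in> topspace X1 \<Longrightarrow> same x (pt x)"
  unfolding pt_def using same_exists same_unique by (metis theI)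

lemma pt_eq: "same x y \<Longrightarrow> pt x = y"
  using same_pt same_unique by (metis same_def)

text \<open>The basic open set \<open>A.sp f\<close> is carried to \<open>B.sp (Phi f)\<close>; that
  the latter is covered comes from \<open>same_exists\<close> for the inverse isomorphism.\<close>

lemma pt_open:
  assumes "openin X1 V"
  shows "openin X2 (pt ` V)"
proof (subst openin_subopen, intro ballI)
  fix y assume "y \<in> pt ` V"
  then obtain x where x: "x \<in> V" "y = pt x" by blast
  then have s: "same x y"
    using same_pt openin_subset[OF assms] by blast
  obtain f where f: "f \<in> Gam1" "x \<in> A.sp f" "A.sp f \<subseteq> V"
    using A.sp_basis[OF assms x(1)] by blast
  have "B.sp (Phi f) \<subseteq> pt ` V"
  proof
    fix y' assume y': "y' \<in> B.sp (Phi f)"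
    then have "y' \<in> topspace X2" using B.sp_closed closedin_subset by blast
    then obtain x' where x': "same x' y'"
      using homeo_group_iso.same_exists[OF swap] same_swap by metis
    then have "x' \<in> V" using y' f by (auto simp: same_def)
    then show "y' \<in> pt ` V" using pt_eq[OF x'] by blast
  qed
  moreover have "openin X2 (B.sp (Phi f))" "y \<in> B.sp (Phi f)"
    using s f B.sp_open[OF Phi_in[OF f(1)]] by (auto simp: same_def B.sp_def)
  ultimately show "\<exists>T. openin X2 T \<and> y \<in> T \<and> T \<subseteq> pt ` V" by blast
qed

theorem spatial_realization:
  obtains t t' where "homeomorphic_maps X1 X2 t t'"
    "\<And>f x. f \<in> Gam1 \<Longrightarrow> x \<in> topspace X1 \<Longrightarrow> t (f x) = Phi f (t x)"
    "\<And>f y. f \<in> Gam2 \<Longrightarrow> y \<in> topspace X2 \<Longrightarrow> t' (f y) = Psi f (t' y)"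
proof -
  interpret S: homeo_group_iso X2 Gam2 X1 Gam1 Psi Phi by (rule swap)
  have inv: "S.pt (pt x) = x" if "x \<in> topspace X1" for x
    using same_pt[OF that] by (intro S.pt_eq) (simp add: same_swap)
  have inv': "pt (S.pt y) = y" if "y \<in> topspace X2" for y
    using S.same_pt[OF that] by (intro pt_eq) (simp add: same_swap)
  have top: "pt x \<in> topspace X2" if "x \<in> topspace X1" for x
    using same_pt[OF that] by (simp add: same_def)
  have top': "S.pt y \<in> topspace X1" if "y \<in> topspace X2" for y
    using S.same_pt[OF that] by (simp add: S.same_def)
  have "homeomorphic_maps X1 X2 pt S.pt"
    by (rule homeomorphic_maps_if_open) (use inv inv' top top' pt_open S.pt_open in auto)
  moreover have "pt (f x) = Phi f (pt x)" if "f \<in> Gam1" "x \<in> topspace X1" for f x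
    using same_equivariant[OF that(1) same_pt[OF that(2)]] by (rule pt_eq)
  moreover have "S.pt (f y) = Psi f (S.pt y)" if "f \<in> Gam2" "y \<in> topspace X2" for f y
    using S.same_equivariant[OF that(1) S.same_pt[OF that(2)]] by (rule S.pt_eq)
  ultimately show ?thesis by (rule that)
qed

end

section \<open>Germs in ample groupoids\<close>

locale gpd =
  fixes G :: "'a tgpd"
  assumes groupoid: "groupoid G"
begin

abbreviation "A \<equiv> arrows G"
abbreviation "c \<equiv> gcomp G"
abbreviation "m \<equiv> gmul G"
abbreviation "i \<equiv> ginv G"
abbreviation "r \<equiv> rng G"
abbreviation "s \<equiv> src G"

lemma groupoid_laws:
  shows i_in: "g \<in> A \<Longrightarrow> i g \<in> A"
    and i_i: "g \<in> A \<Longrightarrow> i (i g) = g"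
    and c_in: "c g h \<Longrightarrow> g \<in> A" "c g h \<Longrightarrow> h \<in> A" "c g h \<Longrightarrow> m g h \<in> A"
    and c_assoc: "c g h \<Longrightarrow> c h k \<Longrightarrow> c (m g h) k" "c g h \<Longrightarrow> c h k \<Longrightarrow> c g (m h k)"
    and assoc: "c g h \<Longrightarrow> c h k \<Longrightarrow> m (m g h) k = m g (m h k)"
    and c_i: "g \<in> A \<Longrightarrow> c (i g) g"
    and cancel: "c g h \<Longrightarrow> m (i g) (m g h) = h" "c g h \<Longrightarrow> m (m g h) (i h) = g"
  using groupoid unfolding groupoid_def by blast+

lemma c_i': "g \<in> A \<Longrightarrow> c g (i g)"
  using c_i[OF i_in] i_i by simp

lemma m_s: "g \<in> A \<Longrightarrow> c g (s g) \<and> m g (s g) = g"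
  unfolding src_def by (metis c_assoc(2) c_i c_i' cancel(1) i_i)

lemma m_r: "g \<in> A \<Longrightarrow> c (r g) g \<and> m (r g) g = g"
  unfolding rng_def by (metis c_assoc(1) c_i c_i' cancel(2) i_i)

text \<open>The axioms do not say that composability means matching ends. If \<open>g\<close> and
  \<open>h\<close> compose, the product of \<open>s g\<close> and \<open>r h\<close> is defined and
  both cancellations apply to it, so it equals each factor. Conversely, associativity across the
  common unit makes \<open>g\<close> and \<open>h\<close> composable.\<close>

lemma c_iff: "c g h \<longleftrightarrow> g \<in> A \<and> h \<in> A \<and> s g = r h"
proof
  assume c: "c g h"
  then have A: "g \<in> A" "h \<in> A" using c_in by auto
  have e: "m (s g) h = h"
    unfolding src_def using assoc[OF c_i[OF A(1)] c] cancel(1)[OF c] by simp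
  have cr: "c g (r h)" "m g (r h) = g"
    unfolding rng_def using c_assoc(2)[OF c c_i'[OF A(2)]] assoc[OF c c_i'[OF A(2)]] cancel(2)[OF c] by auto
  have "c (s g) h"
    unfolding src_def by (rule c_assoc(1)[OF c_i[OF A(1)] c])
  then have "m (s g) (r h) = r h"
    unfolding rng_def using assoc[OF _ c_i'[OF A(2)]] e by metis
  moreover have "m (s g) (r h) = s g"
    using assoc[OF c_i[OF A(1)] cr(1)] cr(2) by (simp add: src_def)
  ultimately show "g \<in> A \<and> h \<in> A \<and> s g = r h" using A by simp
next
  assume "g \<in> A \<and> h \<in> A \<and> s g = r h"
  then show "c g h" using m_s m_r c_assoc(1) by metis
qed

lemma r_i: "g \<in> A \<Longrightarrow> r (i g) = s g"
  by (simp add: rng_def src_def i_i)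

lemma s_i: "g \<in> A \<Longrightarrow> s (i g) = r g"
  by (simp add: rng_def src_def i_i)

lemma m_in: "g \<in> A \<Longrightarrow> h \<in> A \<Longrightarrow> s g = r h \<Longrightarrow> m g h \<in> A"
  using c_iff c_in by blast

lemma r_m: "g \<in> A \<Longrightarrow> h \<in> A \<Longrightarrow> s g = r h \<Longrightarrow> r (m g h) = r g"
  using c_assoc(2)[OF c_i, of g h] c_iff[of "i g" "m g h"] c_iff[of g h] s_i by auto

lemma s_m: "g \<in> A \<Longrightarrow> h \<in> A \<Longrightarrow> s g = r h \<Longrightarrow> s (m g h) = s h"
  using c_assoc(1)[OF _ c_i', of g h] c_iff[of "m g h" "i h"] c_iff[of g h] r_i by auto

lemma units_A: "x \<in> units G \<Longrightarrow> x \<in> A"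
  unfolding units_def rng_def using c_in(3)[OF c_i'] by auto

lemma r_unit: "x \<in> units G \<Longrightarrow> r x = x"
  unfolding units_def using r_m[of _ "i _"] i_in r_i unfolding rng_def by auto

lemma s_unit: "x \<in> units G \<Longrightarrow> s x = x"
proof -
  assume "x \<in> units G"
  then obtain g where "g \<in> A" "x = m g (i g)" unfolding units_def rng_def by auto
  then show "s x = x" using s_m[of g "i g"] by (simp add: i_in r_i s_i) (simp add: rng_def)
qed

lemma r_in: "g \<in> A \<Longrightarrow> r g \<in> units G"
  by (simp add: units_def)

lemma s_in: "g \<in> A \<Longrightarrow> s g \<in> units G"
  using r_in[OF i_in] by (simp add: r_i)

text \<open>Idempotence involves only \<open>gcomp\<close> and \<open>gmul\<close>, which is all
  that an isomorphism is required to preserve; units are transported by this criterion.\<close>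

lemma unit_if_idem: "c g g \<Longrightarrow> m g g = g \<Longrightarrow> g \<in> units G"
  using cancel(2)[of g g] c_in(1)[of g g] r_in[of g] by (simp add: rng_def)

lemma i_m_cancel: "g \<in> A \<Longrightarrow> h \<in> A \<Longrightarrow> r g = r h \<Longrightarrow> m g (m (i g) h) = h"
  using cancel(1)[of "i g" h] by (simp add: c_iff i_in i_i s_i)

end

section \<open>Topology of ample groupoids\<close>

locale ample_gpd =
  fixes G :: "'a tgpd"
  assumes ample: "ample G" and effective: "effective G" and hausdorff: "hausdorff_groupoid G"

sublocale ample_gpd \<subseteq> gpd
  using ample by unfold_locales (simp add: ample_def etale_def topological_groupoid_def)

context ample_gpd
begin

abbreviation "T \<equiv> gtop G"
abbreviation "Y \<equiv> unit_top G"

lemma T_top [simp]: "topspace T = A"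
  by (simp add: arrows_def)

lemma units_sub: "units G \<subseteq> A"
  using units_A by blast

lemma Y_top [simp]: "topspace Y = units G"
  using units_sub by (auto simp: unit_top_def)

lemma mult_cont: "continuous_map (subtopology (prod_topology T T) {(g, h). c g h}) T (\<lambda>(g, h). m g h)"
  and i_cont: "continuous_map T T i"
  and r_locally: "local_homeomorphism T Y r"
  and Y_haus: "Hausdorff_space Y"
  and Y_basis: "openin Y V \<Longrightarrow> x \<in> V \<Longrightarrow>
        \<exists>K. openin Y K \<and> compactin Y K \<and> x \<in> K \<and> K \<subseteq> V"
  using ample by (auto simp: ample_def etale_def topological_groupoid_def)

lemma T_haus: "Hausdorff_space T"
  using hausdorff by (simp add: hausdorff_groupoid_def)

lemma r_cont_T: "continuous_map T T r"
proof -
  have "continuous_map T (subtopology (prod_topology T T) {(g, h). c g h}) (\<lambda>g. (g, i g))"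
    using i_cont c_i' by (auto simp: continuous_map_in_subtopology continuous_map_pairwise o_def)
  from continuous_map_compose[OF this mult_cont] show ?thesis
    by (simp add: o_def rng_def[abs_def])
qed

lemma r_cont: "continuous_map T Y r"
  unfolding unit_top_def using r_cont_T r_in by (auto simp: continuous_map_in_subtopology)

lemma s_cont: "continuous_map T Y s"
  by (rule continuous_map_eq[OF continuous_map_compose[OF i_cont r_cont]]) (simp add: r_i)

lemma r_local:
  assumes "g \<in> A"
  obtains U where "openin T U" "g \<in> U" "openin Y (r ` U)"
    "homeomorphic_map (subtopology T U) (subtopology Y (r ` U)) r"
  using r_locally assms unfolding local_homeomorphism_def by auto

lemma r_local_inj:
  assumes "g \<in> A"
  obtains U where "openin T U" "g \<in> U" "inj_on r U"
proof -
  obtain U where U: "openin T U" "g \<in> U" "homeomorphic_map (subtopology T U) (subtopology Y (r ` U)) r"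
    using r_local[OF assms] by blast
  have "inj_on r U"
    using homeomorphic_imp_injective_map[OF U(3)] openin_subset[OF U(1)] by (simp add: Int_absorb1)
  then show ?thesis using that U by blast
qed

lemma r_open:
  assumes "openin T W"
  shows "openin Y (r ` W)"
proof (subst openin_subopen, intro ballI)
  fix y assume "y \<in> r ` W"
  then obtain g where g: "g \<in> W" "y = r g" by blast
  then have "g \<in> A" using openin_subset[OF assms] by auto
  then obtain U where U: "openin T U" "g \<in> U" "openin Y (r ` U)"
      "homeomorphic_map (subtopology T U) (subtopology Y (r ` U)) r"
    by (rule r_local)
  have "openin (subtopology T U) (U \<inter> W)"
    using assms by (simp add: openin_subtopology_Int2)
  then have "openin (subtopology Y (r ` U)) (r ` (U \<inter> W))"
    using homeomorphic_map_openness_eq[OF U(4)] by blast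
  then have "openin Y (r ` (U \<inter> W))"
    using openin_open_subtopology[OF U(3)] by blast
  then show "\<exists>V. openin Y V \<and> y \<in> V \<and> V \<subseteq> r ` W"
    using U(2) g by blast
qed

lemma i_image: "W \<subseteq> A \<Longrightarrow> i ` W = {g \<in> A. i g \<in> W}"
  using i_in i_i by (force simp: image_iff)

lemma i_open: "openin T W \<Longrightarrow> openin T (i ` W)"
  using i_image[of W] openin_subset[of T W] openin_continuous_map_preimage[OF i_cont, of W] by simp

lemma s_image: "W \<subseteq> A \<Longrightarrow> s ` W = r ` i ` W"
  using r_i by (force simp: image_image)

lemma s_open: "openin T W \<Longrightarrow> openin Y (s ` W)"
  using s_image[of W] openin_subset[of T W] r_open[OF i_open] by simp

lemma s_local_inj:
  assumes "g \<in> A"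
  obtains U where "openin T U" "g \<in> U" "inj_on s U"
proof -
  obtain U where U: "openin T U" "i g \<in> U" "inj_on r U"
    using r_local_inj[OF i_in[OF assms]] by blast
  have sub: "U \<subseteq> A" using openin_subset[OF U(1)] by simp
  have "inj_on s (i ` U)"
    using U(3) sub by (auto simp: inj_on_def s_i subset_iff)
  then show ?thesis
    using that[OF i_open[OF U(1)]] U(2) i_i[OF assms] by (metis image_eqI)
qed

text \<open>Near a unit, both \<open>g\<close> and \<open>r g\<close> lie in a set on which
  \<open>r\<close> is injective, and they have the same range.\<close>

lemma units_open: "openin T (units G)"
proof (subst openin_subopen, intro ballI)
  fix x assume x: "x \<in> units G"
  obtain U where U: "openin T U" "x \<in> U" "inj_on r U"
    using r_local_inj[OF units_A[OF x]] by blast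
  have "openin T (U \<inter> {g \<in> topspace T. r g \<in> U})"
    using U(1) openin_continuous_map_preimage[OF r_cont_T U(1)] by blast
  moreover have "x \<in> U \<inter> {g \<in> topspace T. r g \<in> U}"
    using U(2) x r_unit units_A by auto
  moreover have "U \<inter> {g \<in> topspace T. r g \<in> U} \<subseteq> units G"
  proof
    fix g assume "g \<in> U \<inter> {g \<in> topspace T. r g \<in> U}"
    then have "g = r g" "r g \<in> units G"
      using U(3) r_unit[OF r_in, of g] r_in by (auto simp: inj_on_def)
    then show "g \<in> units G" by simp
  qed
  ultimately show "\<exists>V. openin T V \<and> x \<in> V \<and> V \<subseteq> units G" by blast
qed

lemma openin_Y_iff: "openin Y V \<longleftrightarrow> openin T V \<and> V \<subseteq> units G"
  unfolding unit_top_def by (rule openin_open_subtopology[OF units_open])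

text \<open>The units are the equalizer of \<open>r\<close> and the identity, which is closed
  because the arrow space is Hausdorff. This is what makes supports open in
  \<open>supp_open\<close>.\<close>

lemma units_closed: "closedin T (units G)"
proof -
  have "units G = {g \<in> topspace T. r g = id g}"
    using r_unit units_A r_in by force
  then show ?thesis
    using closedin_continuous_maps_eq[OF T_haus r_cont_T continuous_map_id] by simp
qed

text \<open>Let \<open>q\<close> be a local inverse of \<open>r\<close> near \<open>a\<close>. Every
  \<open>g\<close> close to \<open>m a b\<close> factors as \<open>q (r g)\<close> times
  \<open>m (i (q (r g))) g\<close>, and the second factor depends continuously on \<open>g\<close>
  and equals \<open>b\<close> at the start.\<close>

lemma mult_open:
  assumes A: "openin T A1" and B: "openin T B1"
  shows "openin T {m a b |a b. a \<in> A1 \<and> b \<in> B1 \<and> c a b}"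
proof (subst openin_subopen, intro ballI)
  fix k assume "k \<in> {m a b |a b. a \<in> A1 \<and> b \<in> B1 \<and> c a b}"
  then obtain a b where ab: "k = m a b" "a \<in> A1" "b \<in> B1" "a \<in> A" "b \<in> A" "s a = r b"
    by (auto simp: c_iff)
  obtain U where U: "openin T U" "a \<in> U" "openin Y (r ` U)"
      "homeomorphic_map (subtopology T U) (subtopology Y (r ` U)) r"
    using r_local[OF ab(4)] by blast
  obtain q where q: "homeomorphic_maps (subtopology T U) (subtopology Y (r ` U)) r q"
    using U(4) homeomorphic_map_maps by blast
  have UA: "U \<subseteq> A" using openin_subset[OF U(1)] by simp
  then have qr: "q (r u) = u" if "u \<in> U" for u
    using q that unfolding homeomorphic_maps_def by auto
  define N where "N = {g \<in> topspace T. r g \<in> r ` (A1 \<inter> U)}"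
  have N: "openin T N"
    unfolding N_def by (rule openin_continuous_map_preimage[OF r_cont r_open]) (use A U in blast)
  have NA: "N \<subseteq> A" by (auto simp: N_def)
  have qN: "q (r g) \<in> A1 \<inter> U \<and> r (q (r g)) = r g" if "g \<in> N" for g
    using that qr by (auto simp: N_def)
  have cq: "continuous_map (subtopology T N) T (\<lambda>g. q (r g))"
  proof -
    have "continuous_map (subtopology T N) (subtopology Y (r ` U)) r"
      using continuous_map_from_subtopology[OF r_cont] by (auto simp: continuous_map_in_subtopology N_def)
    moreover have "continuous_map (subtopology Y (r ` U)) T q"
      using q by (simp add: homeomorphic_maps_def continuous_map_in_subtopology)
    ultimately show ?thesis
      using continuous_map_compose by (fastforce simp: o_def)
  qed
  have "continuous_map (subtopology T N) (subtopology (prod_topology T T) {(g, h). c g h}) (\<lambda>g. (i (q (r g)), g))"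
    unfolding continuous_map_in_subtopology continuous_map_pairwise
  proof (intro conjI)
    show "continuous_map (subtopology T N) T (fst \<circ> (\<lambda>g. (i (q (r g)), g)))"
      using continuous_map_compose[OF cq i_cont] by (simp add: o_def)
    show "continuous_map (subtopology T N) T (snd \<circ> (\<lambda>g. (i (q (r g)), g)))"
      by (simp add: o_def continuous_map_from_subtopology)
    show "(\<lambda>g. (i (q (r g)), g)) \<in> topspace (subtopology T N) \<rightarrow> {(g, h). c g h}"
      using qN NA UA by (auto simp: c_iff i_in s_i subset_iff)
  qed
  from continuous_map_compose[OF this mult_cont]
  have F: "continuous_map (subtopology T N) T (\<lambda>g. m (i (q (r g))) g)"
    by (simp add: o_def)
  define P where "P = {g \<in> topspace (subtopology T N). m (i (q (r g))) g \<in> B1}"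
  have "openin (subtopology T N) P"
    unfolding P_def by (rule openin_continuous_map_preimage[OF F B])
  then have "openin T P"
    using openin_open_subtopology[OF N] by blast
  moreover have "k \<in> P"
    using ab U(2) qr[OF U(2)] cancel(1)[of a b]
    by (auto simp: P_def N_def r_m m_in c_iff)
  moreover have "P \<subseteq> {m a b |a b. a \<in> A1 \<and> b \<in> B1 \<and> c a b}"
  proof
    fix g assume "g \<in> P"
    then have g: "g \<in> N" "g \<in> A" "m (i (q (r g))) g \<in> B1" by (auto simp: P_def)
    define a' where "a' = q (r g)"
    have a': "a' \<in> A1" "a' \<in> A" "r a' = r g" using qN[OF g(1)] UA by (auto simp: a'_def)
    have "g = m a' (m (i a') g)" "c a' (m (i a') g)"
      using a' g(2) by (simp_all add: i_m_cancel c_iff m_in i_in s_i r_m r_i)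
    then show "g \<in> {m a b |a b. a \<in> A1 \<and> b \<in> B1 \<and> c a b}"
      using a' g(3) a'_def by blast
  qed
  ultimately show "\<exists>V. openin T V \<and> k \<in> V \<and> V \<subseteq> {m a b |a b. a \<in> A1 \<and> b \<in> B1 \<and> c a b}" by blast
qed

section \<open>Germs, and the full group described by them\<close>

text \<open>Says that the bisections around \<open>g\<close> act like \<open>f\<close> near the
  source of \<open>g\<close>, without choosing a bisection.\<close>

definition germ :: "('a \<Rightarrow> 'a) \<Rightarrow> 'a \<Rightarrow> bool" where
  "germ f g \<longleftrightarrow> (\<exists>W. openin T W \<and> g \<in> W \<and> (\<forall>h\<in>W. r h = f (s h)))"

lemma germ_A: "germ f g \<Longrightarrow> g \<in> A"
  unfolding germ_def using openin_subset[of T] by auto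

lemma germ_r: "germ f g \<Longrightarrow> f (s g) = r g"
  unfolding germ_def by auto

lemma germ_open: "openin T {g. germ f g}"
proof (subst openin_subopen, intro ballI)
  fix g assume "g \<in> {g. germ f g}"
  then obtain W where W: "openin T W" "g \<in> W" "\<forall>h\<in>W. r h = f (s h)"
    unfolding germ_def by blast
  then have "W \<subseteq> {g. germ f g}" unfolding germ_def by blast
  then show "\<exists>V. openin T V \<and> g \<in> V \<and> V \<subseteq> {g. germ f g}" using W by blast
qed

lemma germ_cong:
  assumes "germ f g" "openin Y V" "s g \<in> V" "\<And>x. x \<in> V \<Longrightarrow> f' x = f x"
  shows "germ f' g"
proof -
  obtain W where W: "openin T W" "g \<in> W" "\<forall>h\<in>W. r h = f (s h)"
    using assms(1) unfolding germ_def by blast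
  have "openin T (W \<inter> {h \<in> topspace T. s h \<in> V})"
    using W(1) openin_continuous_map_preimage[OF s_cont assms(2)] by blast
  moreover have "g \<in> W \<inter> {h \<in> topspace T. s h \<in> V}"
    using W(2) assms(3) germ_A[OF assms(1)] by auto
  ultimately show ?thesis
    unfolding germ_def using W(3) assms(4)
    by (intro exI[of _ "W \<inter> {h \<in> topspace T. s h \<in> V}"]) auto
qed

lemma germ_unit:
  assumes "openin Y V" "x \<in> V" "\<And>y. y \<in> V \<Longrightarrow> f y = y"
  shows "germ f x"
proof -
  have V: "openin T V" "V \<subseteq> units G" using assms(1) openin_Y_iff by auto
  have "r h = f (s h)" if "h \<in> V" for h
    using that assms(3)[OF that] r_unit s_unit V(2) by auto
  then show ?thesis unfolding germ_def using V(1) assms(2) by blast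
qed

text \<open>Since multiplication is open, the products of two witnessing neighbourhoods form a
  neighbourhood of the product.\<close>

lemma germ_comp:
  assumes "germ f g" "germ f' g'" "s g = r g'"
  shows "germ (f \<circ> f') (m g g')"
proof -
  obtain W W' where W: "openin T W" "g \<in> W" "\<forall>h\<in>W. r h = f (s h)"
    and W': "openin T W'" "g' \<in> W'" "\<forall>h\<in>W'. r h = f' (s h)"
    using assms(1,2) unfolding germ_def by blast
  have "\<forall>h\<in>{m a b |a b. a \<in> W \<and> b \<in> W' \<and> c a b}. r h = (f \<circ> f') (s h)"
    using W(3) W'(3) by (auto simp: c_iff r_m s_m)
  moreover have "m g g' \<in> {m a b |a b. a \<in> W \<and> b \<in> W' \<and> c a b}"
    using W(2) W'(2) assms germ_A by (auto simp: c_iff)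
  ultimately show ?thesis
    unfolding germ_def using mult_open[OF W(1) W'(1)] by blast
qed

lemma germ_inv:
  assumes "bij f" "germ f g"
  shows "germ (fun_inv f) (i g)"
proof -
  obtain W where W: "openin T W" "g \<in> W" "\<forall>h\<in>W. r h = f (s h)"
    using assms(2) unfolding germ_def by blast
  have "W \<subseteq> A" using openin_subset[OF W(1)] by simp
  then have "r h = fun_inv f (s h)" if "h \<in> i ` W" for h
    using that W(3) bij_inv_simps(1)[OF assms(1)] by (auto simp: r_i s_i subset_iff)
  then show ?thesis
    unfolding germ_def using i_open[OF W(1)] W(2) by blast
qed

text \<open>Two arrows over the same homeomorphism with the same source differ by an interior isotropy element.\<close>

lemma germ_unique:
  assumes "inj f" "germ f g" "germ f g'" "s g = s g'"
  shows "g = g'"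
proof -
  obtain W W' where W: "openin T W" "g \<in> W" "\<forall>h\<in>W. r h = f (s h)"
    and W': "openin T W'" "g' \<in> W'" "\<forall>h\<in>W'. r h = f (s h)"
    using assms(2,3) unfolding germ_def by blast
  have g: "g \<in> A" "g' \<in> A" "r g = r g'"
    using assms germ_A germ_r by metis+
  define O' where "O' = {m a b |a b. a \<in> i ` W \<and> b \<in> W' \<and> c a b}"
  have "openin T O'"
    unfolding O'_def by (rule mult_open[OF i_open[OF W(1)] W'(1)])
  moreover have "O' \<subseteq> {g \<in> A. s g = r g}"
  proof
    fix k assume "k \<in> O'"
    then obtain w b where k: "k = m (i w) b" "w \<in> W" "b \<in> W'" "c (i w) b" by (auto simp: O'_def)
    have w: "w \<in> A" "b \<in> A" "r w = r b"
      using k openin_subset[OF W(1)] by (auto simp: c_iff s_i)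
    then have "s w = s b"
      using W(3) W'(3) k assms(1) by (metis inj_eq)
    then show "k \<in> {g \<in> A. s g = r g}"
      using w by (simp add: k(1) r_m s_m s_i r_i i_in m_in)
  qed
  ultimately have "O' \<subseteq> units G"
    using effective interior_of_maximal unfolding effective_def by metis
  moreover have "m (i g) g' \<in> O'"
  proof -
    have "c (i g) g'" using g by (simp add: c_iff i_in s_i)
    then show ?thesis using W(2) W'(2) unfolding O'_def by blast
  qed
  ultimately have "m (i g) g' \<in> units G" by blast
  then have "m (i g) g' = s g'"
    using s_unit[of "m (i g) g'"] g by (simp add: s_m s_i i_in)
  then have "m g (m (i g) g') = g"
    using m_s[OF g(1)] assms(4) by simp
  then show ?thesis using i_m_cancel[OF g] by simp
qed

text \<open>A description of the full group without bisections, justified by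
  \<open>carrier_tfg\<close>. Asking for some compact set around \<open>moved f\<close>, in place of
  compactness of the support, makes closure under composition immediate.\<close>

definition tfgs :: "('a \<Rightarrow> 'a) set" where
  "tfgs = {f. bij f \<and> (\<exists>C. compactin Y C \<and> moved f \<subseteq> C) \<and> (\<forall>x\<in>units G. \<exists>g. germ f g \<and> s g = x)}"

lemma tfgs_germ: "f \<in> tfgs \<Longrightarrow> x \<in> units G \<Longrightarrow> \<exists>g. germ f g \<and> s g = x"
  by (simp add: tfgs_def)

lemma tfgs_maps:
  assumes "f \<in> tfgs" "x \<in> units G"
  shows "f x \<in> units G"
proof -
  obtain g where "germ f g" "s g = x" using tfgs_germ[OF assms] by blast
  then show ?thesis using germ_r[of f g] r_in[OF germ_A] by auto
qed

lemma tfgs_moved: "f \<in> tfgs \<Longrightarrow> moved f \<subseteq> units G"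
  unfolding tfgs_def using compactin_subset_topspace[of Y] by auto

lemma tfgs_bij: "f \<in> tfgs \<Longrightarrow> bij f"
  by (simp add: tfgs_def)

lemma tfgs_id: "id \<in> tfgs"
proof -
  have "compactin Y {}" by simp
  moreover have "germ id x" if "x \<in> units G" for x
    by (rule germ_unit[of "units G"]) (use that openin_topspace[of Y] in auto)
  ultimately show ?thesis
    unfolding tfgs_def using s_unit by (force simp: moved_def)
qed

lemma tfgs_comp:
  assumes f: "f \<in> tfgs" and g: "g \<in> tfgs"
  shows "f \<circ> g \<in> tfgs"
proof -
  obtain C D where "compactin Y C" "moved f \<subseteq> C" "compactin Y D" "moved g \<subseteq> D"
    using f g unfolding tfgs_def by blast
  then have "compactin Y (C \<union> D)" "moved (f \<circ> g) \<subseteq> C \<union> D"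
    using moved_comp[of f g] by (auto intro: compactin_Un)
  moreover have "\<exists>k. germ (f \<circ> g) k \<and> s k = x" if x: "x \<in> units G" for x
  proof -
    obtain b where b: "germ g b" "s b = x" using tfgs_germ[OF g x] by blast
    obtain a where a: "germ f a" "s a = r b"
      using tfgs_germ[OF f] germ_A[OF b(1)] r_in by blast
    show ?thesis
      using germ_comp[OF a(1) b(1) a(2)] a b germ_A s_m by metis
  qed
  ultimately show ?thesis
    using f g unfolding tfgs_def by (auto intro: bij_comp)
qed

lemma tfgs_inv:
  assumes f: "f \<in> tfgs"
  shows "fun_inv f \<in> tfgs"
proof -
  have b: "bij f" by (rule tfgs_bij[OF f])
  have "\<exists>k. germ (fun_inv f) k \<and> s k = x" if x: "x \<in> units G" for x
  proof -
    have fx: "f (fun_inv f x) = x" by (rule bij_inv_simps(2)[OF b])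
    have "fun_inv f x \<in> units G"
    proof (rule ccontr)
      assume a: "fun_inv f x \<notin> units G"
      then have "f (fun_inv f x) = fun_inv f x" using tfgs_moved[OF f] by (auto simp: moved_def)
      then show False using a x fx by simp
    qed
    then obtain g where g: "germ f g" "s g = fun_inv f x" using tfgs_germ[OF f] by blast
    show ?thesis
      using germ_inv[OF b g(1)] g fx germ_r[OF g(1)] s_i[OF germ_A[OF g(1)]] by auto
  qed
  then show ?thesis
    using f unfolding tfgs_def by (auto simp: bij_imp_bij_inv moved_inv)
qed

text \<open>The full bisection inducing \<open>f\<close> is recovered as \<open>{g. germ f g}\<close>.\<close>

lemma carrier_tfg: "carrier (tfg G) = tfgs"
proof (intro subset_antisym subsetI)
  fix f assume "f \<in> carrier (tfg G)"
  then obtain U where U: "f = pi_bis G U" "openin T U" "inj_on s U" "inj_on r U"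
      "s ` U = units G" "r ` U = units G" "compactin Y (supp G f)"
    by (auto simp: tfg_def full_bisection_def bisection_def)
  have UA: "U \<subseteq> A" using openin_subset[OF U(2)] by simp
  have fs: "f (s h) = r h" if "h \<in> U" for h
    using that U(1,3) UA s_in by (auto simp: pi_bis_def the_inv_into_f_f)
  have off: "f x = x" if "x \<notin> units G" for x
    using that U(1) by (simp add: pi_bis_def)
  have "bij_betw f (units G) (units G)"
  proof (rule bij_betwI')
    fix x y assume "x \<in> units G" "y \<in> units G"
    then obtain a b where "a \<in> U" "b \<in> U" "x = s a" "y = s b" using U(5) by blast
    then show "f x = f y \<longleftrightarrow> x = y"
      using fs U(3,4) by (metis inj_onD)
  next
    fix x assume "x \<in> units G"
    then obtain a where "a \<in> U" "x = s a" using U(5) by blast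
    then show "f x \<in> units G" using fs UA r_in by auto
  next
    fix y assume "y \<in> units G"
    then obtain a where "a \<in> U" "y = r a" using U(6) by blast
    then show "\<exists>x\<in>units G. y = f x" using fs UA s_in by (metis subsetD)
  qed
  then have "bij_betw f (units G \<union> - units G) (units G \<union> - units G)"
    by (rule bij_betw_combine) (auto simp: bij_betw_def inj_on_def off)
  then have "bij f" by simp
  moreover have "moved f \<subseteq> supp G f"
  proof -
    have "moved f = {x \<in> units G. f x \<noteq> x}" using off by (auto simp: moved_def)
    then show ?thesis unfolding supp_def using closure_of_subset[of "moved f" Y] by auto
  qed
  moreover have "germ f h" if "h \<in> U" for h
    unfolding germ_def using U(2) fs that by metis
  then have "\<forall>x\<in>units G. \<exists>g. germ f g \<and> s g = x"
    using U(5) by (metis imageE)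
  ultimately show "f \<in> tfgs"
    unfolding tfgs_def using U(7) by blast
next
  fix f assume f: "f \<in> tfgs"
  define U where "U = {g. germ f g}"
  have inj: "inj f" using tfgs_bij[OF f] bij_is_inj by blast
  have UA: "U \<subseteq> A" using germ_A by (auto simp: U_def)
  have js: "inj_on s U"
    using germ_unique[OF inj] by (auto simp: inj_on_def U_def)
  have "inj_on r U"
  proof (rule inj_onI)
    fix g h assume gh: "g \<in> U" "h \<in> U" "r g = r h"
    then have "f (s g) = f (s h)" using germ_r by (simp add: U_def)
    then have "s g = s h" by (rule injD[OF inj])
    then show "g = h" using gh(1,2) by (rule inj_onD[OF js])
  qed
  moreover have sU: "s ` U = units G"
  proof
    show "s ` U \<subseteq> units G" using UA s_in by auto
    show "units G \<subseteq> s ` U" using tfgs_germ[OF f] unfolding U_def by blast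
  qed
  moreover have "r ` U = units G"
  proof
    show "r ` U \<subseteq> units G" using UA r_in by auto
    show "units G \<subseteq> r ` U"
    proof
      fix y assume y: "y \<in> units G"
      have "fun_inv f y \<in> units G" by (rule tfgs_maps[OF tfgs_inv[OF f] y])
      then obtain g where "germ f g" "s g = fun_inv f y" using tfgs_germ[OF f] by blast
      then have "g \<in> U" "r g = y"
        using germ_r bij_inv_simps(2)[OF tfgs_bij[OF f], of y] by (auto simp: U_def)
      then show "y \<in> r ` U" by blast
    qed
  qed
  ultimately have full: "full_bisection G U"
    using js germ_open[of f] by (simp add: full_bisection_def bisection_def U_def)
  have pi: "pi_bis G U = f"
  proof
    fix x
    show "pi_bis G U x = f x"
    proof (cases "x \<in> units G")
      case True
      then obtain g where g: "g \<in> U" "x = s g" using sU by blast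
      then have "f x = r g" using germ_r by (simp add: U_def)
      then show ?thesis
        using g True js by (simp add: pi_bis_def the_inv_into_f_f)
    next
      case False
      then show ?thesis
        using tfgs_moved[OF f] not_moved[of x f] by (auto simp: pi_bis_def)
    qed
  qed
  obtain C where C: "compactin Y C" "moved f \<subseteq> C" using f unfolding tfgs_def by blast
  have "supp G f \<subseteq> C"
    unfolding supp_def using C compactin_imp_closedin[OF Y_haus]
    by (intro closure_of_minimal) (auto simp: moved_def)
  then have "compactin Y (supp G f)"
    by (rule closed_compactin[OF C(1)]) (simp add: supp_def)
  then show "f \<in> carrier (tfg G)"
    unfolding tfg_def using full pi by auto
qed

lemma tfg_simps [simp]: "mult (tfg G) = (\<circ>)" "one (tfg G) = id"
  by (simp_all add: tfg_def)

lemma group_tfg: "group (tfg G)"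
proof (rule groupI)
  show "\<exists>y\<in>carrier (tfg G). y \<otimes>\<^bsub>tfg G\<^esub> x = \<one>\<^bsub>tfg G\<^esub>" if "x \<in> carrier (tfg G)" for x
    using that tfgs_inv bij_inv_simps(1)[OF tfgs_bij, of x] unfolding carrier_tfg
    by (intro bexI[of _ "fun_inv x"]) (auto simp: fun_eq_iff)
qed (auto simp: carrier_tfg tfgs_comp tfgs_id)

lemma inv_tfg:
  assumes "f \<in> tfgs"
  shows "inv\<^bsub>tfg G\<^esub> f = fun_inv f"
  using group.inv_equality[OF group_tfg, of "fun_inv f" f] assms tfgs_inv[OF assms] bij_inv_simps(1)[OF tfgs_bij[OF assms]]
  by (auto simp: carrier_tfg fun_eq_iff)

text \<open>A unit avoids the support exactly when \<open>f\<close> is the identity near it, that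
  is, when the arrow of the bisection of \<open>f\<close> over it is the unit itself;
  \<open>germ_unique\<close> excludes any second arrow. The first form shows the support as the
  source image of an open set.\<close>

lemma supp_eq:
  assumes f: "f \<in> tfgs"
  shows "Y closure_of moved f = s ` {g. germ f g \<and> g \<notin> units G}" (is "_ = ?R")
    and "Y closure_of moved f = units G - {x \<in> units G. germ f x}"
proof -
  have inj: "inj f" using tfgs_bij[OF f] bij_is_inj by blast
  have eq: "?R = units G - {x \<in> units G. germ f x}"
  proof (intro subset_antisym subsetI)
    fix x assume "x \<in> ?R"
    then obtain g where g: "germ f g" "g \<notin> units G" "x = s g" by auto
    then have x: "x \<in> units G" "s g = s x"
      using s_in[OF germ_A[OF g(1)]] s_unit by auto
    have "\<not> germ f x"
      using germ_unique[OF inj g(1) _ x(2)] g(2) x(1) by blast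
    then show "x \<in> units G - {x \<in> units G. germ f x}"
      using x(1) by simp
  next
    fix x assume x: "x \<in> units G - {x \<in> units G. germ f x}"
    then obtain g where g: "germ f g" "s g = x" using tfgs_germ[OF f] by blast
    then have "g \<notin> units G" using x s_unit by auto
    then show "x \<in> ?R" using g by auto
  qed
  show "Y closure_of moved f = units G - {x \<in> units G. germ f x}"
  proof (intro subset_antisym subsetI)
    fix x assume x: "x \<in> Y closure_of moved f"
    have "\<not> germ f x"
    proof
      assume "germ f x"
      then obtain W where W: "openin T W" "x \<in> W" "\<forall>h\<in>W. r h = f (s h)" unfolding germ_def by blast
      have "openin Y (W \<inter> units G)" "x \<in> W \<inter> units G"
        using W x units_open in_closure_of[of x Y] by (auto simp: openin_Y_iff)
      then obtain y where "y \<in> moved f" "y \<in> W \<inter> units G"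
        using x unfolding in_closure_of by blast
      then show False using W(3) r_unit s_unit by (auto simp: moved_def)
    qed
    then show "x \<in> units G - {x \<in> units G. germ f x}"
      using x in_closure_of[of x Y] by auto
  next
    fix x assume x: "x \<in> units G - {x \<in> units G. germ f x}"
    show "x \<in> Y closure_of moved f"
      unfolding in_closure_of
    proof (intro conjI allI impI)
      show "x \<in> topspace Y" using x by simp
      fix V assume V: "x \<in> V \<and> openin Y V"
      show "\<exists>y. y \<in> moved f \<and> y \<in> V"
      proof (rule ccontr)
        assume "\<not> ?thesis"
        then have "germ f x" using V by (intro germ_unit[of V]) (auto simp: moved_def)
        then show False using x by simp
      qed
    qed
  qed
  then show "Y closure_of moved f = ?R" using eq by simp
qed

lemma supp_open: "f \<in> tfgs \<Longrightarrow> openin Y (Y closure_of moved f)"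
proof -
  assume f: "f \<in> tfgs"
  have "{g. germ f g \<and> g \<notin> units G} = {g. germ f g} - units G" by blast
  then show ?thesis
    unfolding supp_eq(1)[OF f] using germ_open[of f] units_closed by (auto intro!: s_open openin_diff)
qed

lemma supp_compact: "f \<in> tfgs \<Longrightarrow> compactin Y (Y closure_of moved f)"
proof -
  assume "f \<in> tfgs"
  then obtain C where C: "compactin Y C" "moved f \<subseteq> C" unfolding tfgs_def by blast
  have "Y closure_of moved f \<subseteq> C"
    using C compactin_imp_closedin[OF Y_haus] by (intro closure_of_minimal) auto
  then show ?thesis by (rule closed_compactin[OF C(1)]) simp
qed

lemma tfgs_open_image:
  assumes f: "f \<in> tfgs" and V: "openin Y V"
  shows "openin Y (f ` V)"
proof -
  define W where "W = {g. germ f g} \<inter> {g \<in> topspace T. s g \<in> V}"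
  have "openin T W"
    unfolding W_def using germ_open openin_continuous_map_preimage[OF s_cont V] by blast
  moreover have "f ` V = r ` W"
  proof (intro subset_antisym subsetI)
    fix y assume "y \<in> f ` V"
    then obtain x where x: "x \<in> V" "y = f x" by blast
    then obtain g where g: "germ f g" "s g = x"
      using tfgs_germ[OF f] openin_subset[OF V] by auto
    then have "g \<in> W" "y = r g" using x germ_A germ_r by (auto simp: W_def)
    then show "y \<in> r ` W" by blast
  qed (use germ_r in \<open>force simp: W_def\<close>)
  ultimately show ?thesis using r_open by simp
qed

end

section \<open>Compact bisections and involutions\<close>

context ample_gpd
begin

lemma s_embedding:
  assumes "openin T U" "inj_on s U"
  shows "homeomorphic_map (subtopology T U) (subtopology Y (s ` U)) s"
proof -
  have top: "topspace (subtopology T U) = U"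
    using openin_subset[OF assms(1)] by auto
  have "embedding_map (subtopology T U) Y s"
  proof (rule injective_open_imp_embedding_map)
    show "continuous_map (subtopology T U) Y s"
      by (rule continuous_map_from_subtopology[OF s_cont])
    show "open_map (subtopology T U) Y s"
      unfolding open_map_def using s_open openin_open_subtopology[OF assms(1)] by blast
    show "inj_on s (topspace (subtopology T U))" unfolding top by (rule assms(2))
  qed
  then show ?thesis
    unfolding embedding_map_def top .
qed

text \<open>On a small bisection \<open>s\<close> is a homeomorphism onto an open set. Restricting
  to the arrows over a compact open neighbourhood of \<open>s g\<close> makes the source image
  compact, and the range image is a continuous image of it.\<close>

lemma compact_bisection:
  assumes g: "g \<in> A" and W: "openin T W" "g \<in> W"
  obtains U where "openin T U" "g \<in> U" "U \<subseteq> W" "inj_on s U" "inj_on r U"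
    "compactin Y (s ` U)" "compactin Y (r ` U)"
proof -
  obtain U0 where U0: "openin T U0" "g \<in> U0" "inj_on s U0" using s_local_inj[OF g] by blast
  obtain U1 where U1: "openin T U1" "g \<in> U1" "inj_on r U1" using r_local_inj[OF g] by blast
  define U where "U = U0 \<inter> U1 \<inter> W"
  have U: "openin T U" "g \<in> U" using U0 U1 W by (auto simp: U_def)
  have js: "inj_on s U" using U0(3) by (rule inj_on_subset) (auto simp: U_def)
  have jr: "inj_on r U" using U1(3) by (rule inj_on_subset) (auto simp: U_def)
  obtain K where K: "openin Y K" "compactin Y K" "s g \<in> K" "K \<subseteq> s ` U"
    using Y_basis[OF s_open[OF U(1)], of "s g"] U(2) by blast
  define B where "B = U \<inter> {g \<in> topspace T. s g \<in> K}"
  have UA: "U \<subseteq> A" using openin_subset[OF U(1)] by simp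
  have Bo: "openin T B"
    unfolding B_def using U(1) openin_continuous_map_preimage[OF s_cont K(1)] by blast
  have sB: "s ` B = K" using K(4) UA by (auto simp: B_def)
  obtain q where q: "homeomorphic_maps (subtopology T U) (subtopology Y (s ` U)) s q"
    using s_embedding[OF U(1) js] homeomorphic_map_maps by blast
  have qs: "q (s u) = u" if "u \<in> U" for u
    using q that UA unfolding homeomorphic_maps_def by auto
  have "compactin (subtopology Y (s ` U)) K"
    using K by (simp add: compactin_subtopology)
  then have "compactin (subtopology T U) (q ` K)"
    using q image_compactin unfolding homeomorphic_maps_def by blast
  then have "compactin T (q ` K)" by (simp add: compactin_subtopology)
  then have "compactin Y (r ` q ` K)" by (rule image_compactin[OF _ r_cont])
  moreover have "q ` K = B"
    unfolding sB[symmetric] image_image using qs by (auto simp: B_def)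
  ultimately have "compactin Y (r ` B)" by simp
  moreover have "inj_on s B" "inj_on r B"
    using js jr by (auto simp: B_def intro: inj_on_subset)
  moreover have "g \<in> B" "B \<subseteq> W" using U(2) K(3) g by (auto simp: B_def U_def)
  ultimately show ?thesis using that[OF Bo] K(2) sB by simp
qed

text \<open>A compact bisection \<open>U\<close> from \<open>V1\<close> to \<open>V2\<close> is
  glued with its inverse and with the remaining units. The source and range of \<open>U\<close> are
  disjoint, so the exchange is well defined; they are compact, hence closed, so the remaining units
  form an open set on which \<open>a\<close> has unit germs.\<close>

lemma involution:
  assumes g: "g \<in> A" and V: "openin Y V1" "openin Y V2" "s g \<in> V1" "r g \<in> V2" "V1 \<inter> V2 = {}"
  obtains a where "a \<in> tfgs" "a \<circ> a = id" "germ a g" "moved a \<subseteq> V1 \<union> V2"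
proof -
  define W where "W = {g \<in> topspace T. s g \<in> V1} \<inter> {g \<in> topspace T. r g \<in> V2}"
  have "openin T W" "g \<in> W"
    unfolding W_def using V g openin_continuous_map_preimage[OF s_cont] openin_continuous_map_preimage[OF r_cont] by auto
  then obtain U where U: "openin T U" "g \<in> U" "U \<subseteq> W" "inj_on s U" "inj_on r U"
      "compactin Y (s ` U)" "compactin Y (r ` U)"
    using compact_bisection[OF g] by blast
  have UA: "U \<subseteq> A" using openin_subset[OF U(1)] by simp
  have V12: "s u \<in> V1" "r u \<in> V2" if "u \<in> U" for u
    using that U(3) by (auto simp: W_def)
  have dis: "r u \<noteq> s v" if "u \<in> U" "v \<in> U" for u v
    using V12(1)[OF that(2)] V12(2)[OF that(1)] V(5) by auto
  define a where "a x = (if x \<in> s ` U then r (the_inv_into U s x)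
      else if x \<in> r ` U then s (the_inv_into U r x) else x)" for x
  have as: "a (s u) = r u" if "u \<in> U" for u
    using that U(4) by (simp add: a_def the_inv_into_f_f)
  have ar: "a (r u) = s u" if "u \<in> U" for u
  proof -
    have "r u \<notin> s ` U" using dis[OF that] by blast
    then show ?thesis using that U(5) by (simp add: a_def the_inv_into_f_f)
  qed
  have ao: "a x = x" if "x \<notin> s ` U" "x \<notin> r ` U" for x
    using that by (simp add: a_def)
  have aa: "a \<circ> a = id"
  proof
    fix x
    consider u where "u \<in> U" "x = s u" | u where "u \<in> U" "x = r u" | "x \<notin> s ` U" "x \<notin> r ` U"
      by blast
    then show "(a \<circ> a) x = id x"
    proof cases
      case (1 u)
      then show ?thesis using as[of u] ar[of u] by simp
    next
      case (2 u)
      then show ?thesis using as[of u] ar[of u] by simp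
    next
      case 3
      then show ?thesis using ao[of x] by simp
    qed
  qed
  have mv: "moved a \<subseteq> s ` U \<union> r ` U"
    using ao by (auto simp: moved_def)
  have ga: "germ a u" if "u \<in> U" for u
    unfolding germ_def using that as U(1) by metis
  have ga': "germ a (i u)" if "u \<in> U" for u
  proof -
    have "r h = a (s h)" if "h \<in> i ` U" for h
      using that ar UA by (auto simp: r_i s_i subset_iff)
    then show ?thesis unfolding germ_def using i_open[OF U(1)] that by blast
  qed
  have "\<exists>k. germ a k \<and> s k = x" if x: "x \<in> units G" for x
  proof -
    consider u where "u \<in> U" "x = s u" | u where "u \<in> U" "x = r u" | "x \<notin> s ` U" "x \<notin> r ` U"
      by blast
    then show ?thesis
    proof cases
      case 3
      have "closedin Y (s ` U \<union> r ` U)"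
        using U(6,7) compactin_imp_closedin[OF Y_haus] by blast
      then have "openin Y (units G - (s ` U \<union> r ` U))"
        by (simp add: closedin_def)
      then have "germ a x"
        by (rule germ_unit) (use 3 x ao in auto)
      then show ?thesis using s_unit[OF x] by blast
    next
      case (1 u)
      then show ?thesis using ga by blast
    next
      case (2 u)
      then show ?thesis using ga'[of u] s_i[of u] UA by blast
    qed
  qed
  moreover have "bij a" using aa by (rule o_bij) (rule aa)
  moreover have "compactin Y (s ` U \<union> r ` U)" using U(6,7) by (rule compactin_Un)
  ultimately have "a \<in> tfgs" unfolding tfgs_def using mv by blast
  moreover have "moved a \<subseteq> V1 \<union> V2" using mv V12 by blast
  ultimately show ?thesis using that aa ga[OF U(2)] by blast
qed

end

section \<open>Realizing arrows by commutators\<close>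

locale min_ample_gpd = ample_gpd +
  assumes minimal: "minimal G" and no_isolated: "no_isolated_units G"
begin

lemma orbit_meets:
  assumes x: "x \<in> units G" and V: "openin Y V" "V \<noteq> {}"
  obtains g where "g \<in> A" "s g = x" "r g \<in> V"
proof -
  obtain y where y: "y \<in> V" using V(2) by blast
  then have "y \<in> Y closure_of orbit G x"
    using minimal x openin_subset[OF V(1)] unfolding minimal_def by auto
  then obtain z where "z \<in> orbit G x" "z \<in> V"
    using V(1) y unfolding in_closure_of by blast
  then show ?thesis using that by (auto simp: orbit_def)
qed

lemma open_delete:
  assumes V: "openin Y V" "V \<noteq> {}"
  shows "openin Y (V - {x})" "V - {x} \<noteq> {}"
proof -
  show "openin Y (V - {x})" by (rule open_in_Hausdorff_delete[OF Y_haus V(1)])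
  show "V - {x} \<noteq> {}"
  proof
    assume "V - {x} = {}"
    then have "V = {x}" using V(2) by blast
    then show False
      using V(1) openin_subset[OF V(1)] no_isolated by (auto simp: no_isolated_units_def)
  qed
qed

text \<open>The commutator of the transpositions \<open>(x y)\<close> and \<open>(x z)\<close> is a 3-cycle sending \<open>x\<close> to \<open>y\<close>.\<close>

lemma derived_realizes:
  assumes g: "g \<in> A" "s g \<noteq> r g" and V: "openin Y V" "s g \<in> V" "r g \<in> V"
  shows "\<exists>f\<in>derived (tfg G) (carrier (tfg G)). germ f g \<and> moved f \<subseteq> V"
proof -
  have V1: "openin Y (V - {s g})" "V - {s g} \<noteq> {}"
    using open_delete[OF V(1)] V(2) by blast+
  then have "openin Y (V - {s g} - {r g})" "V - {s g} - {r g} \<noteq> {}"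
    using open_delete[OF V1] by blast+
  \<comment> \<open>The third point of the cycle is \<open>r h\<close>: deleting both ends of
    \<open>g\<close> from \<open>V\<close> leaves a nonempty open set, which the orbit of
    \<open>s g\<close> meets.\<close>
  then obtain h where h: "h \<in> A" "s h = s g" "r h \<in> V - {s g} - {r g}"
    using orbit_meets[OF s_in[OF g(1)]] by blast
  have sep: "\<exists>P Q. openin Y P \<and> openin Y Q \<and> x \<in> P \<and> y \<in> Q \<and> P \<inter> Q = {}"
    if "x \<in> units G" "y \<in> units G" "x \<noteq> y" for x y
    using Y_haus that unfolding Hausdorff_space_def disjnt_def by simp
  have un: "s g \<in> units G" "r g \<in> units G" "r h \<in> units G"
    using g(1) h(1) s_in r_in by auto
  have ne: "s g \<noteq> r h" "r g \<noteq> r h" using h(3) by auto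
  obtain A1 B1 where 1: "openin Y A1" "openin Y B1" "s g \<in> A1" "r g \<in> B1" "A1 \<inter> B1 = {}"
    using sep[OF un(1,2) g(2)] by blast
  obtain A2 C2 where 2: "openin Y A2" "openin Y C2" "s g \<in> A2" "r h \<in> C2" "A2 \<inter> C2 = {}"
    using sep[OF un(1,3) ne(1)] by blast
  obtain B3 C3 where 3: "openin Y B3" "openin Y C3" "r g \<in> B3" "r h \<in> C3" "B3 \<inter> C3 = {}"
    using sep[OF un(2,3) ne(2)] by blast
  define Vx where "Vx = A1 \<inter> A2 \<inter> V"
  define Vy where "Vy = B1 \<inter> B3 \<inter> V"
  define Vz where "Vz = C2 \<inter> C3 \<inter> V"
  have op: "openin Y Vx" "openin Y Vy" "openin Y Vz"
    using 1 2 3 V(1) by (auto simp: Vx_def Vy_def Vz_def)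
  have mem: "s g \<in> Vx" "r g \<in> Vy" "r h \<in> Vz"
    using 1 2 3 V h(3) by (auto simp: Vx_def Vy_def Vz_def)
  have dis: "Vx \<inter> Vy = {}" "Vx \<inter> Vz = {}" "Vy \<inter> Vz = {}"
    using 1(5) 2(5) 3(5) by (auto simp: Vx_def Vy_def Vz_def)
  obtain a where a: "a \<in> tfgs" "a \<circ> a = id" "germ a g" "moved a \<subseteq> Vx \<union> Vy"
    by (rule involution[OF g(1) op(1,2) mem(1,2) dis(1)])
  obtain b where b: "b \<in> tfgs" "b \<circ> b = id" "germ b h" "moved b \<subseteq> Vx \<union> Vz"
    by (rule involution[OF h(1) op(1,3) _ mem(3) dis(2)]) (use h mem in auto)
  have ib: "fun_inv b = b" "fun_inv a = a"
    using a b by (auto intro: inv_unique_comp)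
  \<comment> \<open>The arrow over \<open>s g\<close> is traced through the four factors:
    \<open>b\<close> moves along \<open>h\<close>, \<open>a\<close> fixes a neighbourhood of
    \<open>r h\<close>, \<open>b\<close> returns along \<open>i h\<close>, and \<open>a\<close>
    moves along \<open>g\<close>.\<close>
  have "germ a (r h)"
    by (rule germ_unit[OF op(3) mem(3)]) (use a(4) dis not_moved[of _ a] in blast)
  from germ_comp[OF this b(3)] have 1: "germ (a \<circ> b) h"
    using m_r[OF h(1)] s_unit[OF r_in[OF h(1)]] by simp
  have "germ b (i h)"
    using germ_inv[OF tfgs_bij[OF b(1)] b(3)] ib by simp
  from germ_comp[OF this 1] have 2: "germ (b \<circ> (a \<circ> b)) (s g)"
    using s_i[OF h(1)] h(2) by (simp add: src_def)
  from germ_comp[OF a(3) 2] have "germ (a \<circ> (b \<circ> (a \<circ> b))) g"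
    using m_s[OF g(1)] r_unit[OF s_in[OF g(1)]] by simp
  moreover define f where "f = a \<circ> b \<circ> a \<circ> b"
  ultimately have "germ f g" by (simp add: comp_assoc)
  moreover have "f \<in> derived (tfg G) (carrier (tfg G))"
  proof -
    have "f = a \<otimes>\<^bsub>tfg G\<^esub> b \<otimes>\<^bsub>tfg G\<^esub> inv\<^bsub>tfg G\<^esub> a \<otimes>\<^bsub>tfg G\<^esub> inv\<^bsub>tfg G\<^esub> b"
      using inv_tfg a(1) b(1) ib by (simp add: f_def)
    then show ?thesis
      unfolding derived_def using a(1) b(1) by (intro generate.incl) (auto simp: carrier_tfg)
  qed
  moreover have "moved f \<subseteq> V"
  proof -
    have "moved f \<subseteq> moved a \<union> moved b" unfolding f_def moved_def by auto
    then show ?thesis using a(4) b(4) by (auto simp: Vx_def Vy_def Vz_def)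
  qed
  ultimately show ?thesis by blast
qed

text \<open>An isotropy arrow is out of reach of \<open>derived_realizes\<close>, whose involutions
  need disjoint neighbourhoods of the two ends. It is written as \<open>m k h\<close>, where
  \<open>h\<close> leads from its source to a different unit and \<open>k\<close> leads back; both
  have distinct ends.\<close>

lemma realized_in:
  assumes D: "derived (tfg G) (carrier (tfg G)) \<subseteq> Gam" and cl: "\<And>f f'. f \<in> Gam \<Longrightarrow> f' \<in> Gam \<Longrightarrow> f \<circ> f' \<in> Gam"
    and g: "g \<in> A"
  shows "\<exists>f\<in>Gam. germ f g"
proof -
  have top: "openin Y (units G)" using openin_topspace[of Y] by simp
  have off: "\<exists>f\<in>Gam. germ f g" if "g \<in> A" "s g \<noteq> r g" for g
    using derived_realizes[OF that top] s_in r_in that D by blast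
  show ?thesis
  proof (cases "s g = r g")
    case True
    have "units G \<noteq> {}" using s_in[OF g] by blast
    from open_delete[OF top this]
    obtain h where h: "h \<in> A" "s h = s g" "r h \<in> units G - {s g}"
      using orbit_meets[OF s_in[OF g]] by blast
    define k where "k = m g (i h)"
    have k: "k \<in> A" "s k = r h" "r k = r g"
      using g h True by (simp_all add: k_def m_in i_in r_i s_i s_m r_m)
    have "m k h = g"
      using cancel(2)[of g "i h"] g h(1,2) by (simp add: k_def c_iff i_in i_i r_i)
    moreover obtain f where "f \<in> Gam" "germ f k" using off[OF k(1)] k True h by auto
    moreover obtain f' where "f' \<in> Gam" "germ f' h" using off[OF h(1)] h by auto
    ultimately show ?thesis using germ_comp[of f k f' h] k(2) cl by auto
  qed (use off g in blast)
qed

lemma homeo_group_if_derived_subset: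
  assumes sub: "subgroup Gam (tfg G)" and D: "derived (tfg G) (carrier (tfg G)) \<subseteq> Gam"
  shows "homeo_group Y Gam"
proof
  have le: "f \<in> tfgs" if "f \<in> Gam" for f
    using subgroup.subset[OF sub] that by (auto simp: carrier_tfg)
  show "Hausdorff_space Y" by (rule Y_haus)
  show "id \<in> Gam" using subgroup.one_closed[OF sub] by simp
  show "f \<circ> g \<in> Gam" if "f \<in> Gam" "g \<in> Gam" for f g
    using subgroup.m_closed[OF sub that] by simp
  show "fun_inv f \<in> Gam" if "f \<in> Gam" for f
    using subgroup.m_inv_closed[OF sub that] inv_tfg[OF le[OF that]] by simp
  show "bij f" if "f \<in> Gam" for f by (rule tfgs_bij[OF le[OF that]])
  show "openin Y (f ` V)" if "f \<in> Gam" "openin Y V" for f V by (rule tfgs_open_image[OF le[OF that(1)] that(2)])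
  show "moved f \<subseteq> topspace Y" if "f \<in> Gam" for f using tfgs_moved[OF le[OF that]] by simp
  show "openin Y (Y closure_of moved f)" if "f \<in> Gam" for f by (rule supp_open[OF le[OF that]])
  show "compactin Y (Y closure_of moved f)" if "f \<in> Gam" for f by (rule supp_compact[OF le[OF that]])
  \<comment> \<open>There remains \<open>move\<close>. Some arrow leads from \<open>x\<close> to
    another point of a compact open \<open>K\<close> inside \<open>V\<close>; a group element
    realizing it moves points of \<open>K\<close> only, and \<open>K\<close> is closed, so it
    contains the support.\<close>
  fix V x assume V: "openin Y V" "x \<in> V"
  obtain K where K: "openin Y K" "compactin Y K" "x \<in> K" "K \<subseteq> V"
    using Y_basis[OF V] by blast
  have x: "x \<in> units G" using openin_subset[OF V(1)] V(2) by auto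
  have "K \<noteq> {}" using K(3) by blast
  from open_delete[OF K(1) this] obtain g where g: "g \<in> A" "s g = x" "r g \<in> K - {x}"
    using orbit_meets[OF x] by blast
  then have "s g \<noteq> r g" "s g \<in> K" "r g \<in> K" using K(3) by auto
  then obtain f where f: "f \<in> Gam" "germ f g" "moved f \<subseteq> K"
    using derived_realizes[OF g(1) _ K(1)] D by blast
  have "Y closure_of moved f \<subseteq> K"
    by (rule closure_of_minimal[OF f(3) compactin_imp_closedin[OF Y_haus K(2)]])
  moreover have "f x \<noteq> x" using germ_r[OF f(2)] g by auto
  ultimately show "\<exists>f\<in>Gam. f x \<noteq> x \<and> Y closure_of moved f \<subseteq> V"
    using f(1) K(4) by blast
qed

end

section \<open>From groups back to groupoids\<close>

locale spatial_pair = L: ample_gpd G1 + R: ample_gpd G2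
  for G1 :: "'a tgpd" and G2 :: "'b tgpd" +
  fixes Gam1 :: "('a \<Rightarrow> 'a) set" and Gam2 :: "('b \<Rightarrow> 'b) set"
    and Phi :: "('a \<Rightarrow> 'a) \<Rightarrow> 'b \<Rightarrow> 'b" and Psi :: "('b \<Rightarrow> 'b) \<Rightarrow> 'a \<Rightarrow> 'a"
    and t :: "'a \<Rightarrow> 'b" and t' :: "'b \<Rightarrow> 'a"
  assumes Phi_in: "f \<in> Gam1 \<Longrightarrow> Phi f \<in> Gam2"
    and Psi_in: "f' \<in> Gam2 \<Longrightarrow> Psi f' \<in> Gam1"
    and Psi_Phi: "f \<in> Gam1 \<Longrightarrow> Psi (Phi f) = f"
    and Phi_Psi: "f' \<in> Gam2 \<Longrightarrow> Phi (Psi f') = f'"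
    and Phi_comp: "f \<in> Gam1 \<Longrightarrow> g \<in> Gam1 \<Longrightarrow> Phi (f \<circ> g) = Phi f \<circ> Phi g"
    and Psi_comp: "f' \<in> Gam2 \<Longrightarrow> g' \<in> Gam2 \<Longrightarrow> Psi (f' \<circ> g') = Psi f' \<circ> Psi g'"
    and maps: "homeomorphic_maps (unit_top G1) (unit_top G2) t t'"
    and t_equiv: "f \<in> Gam1 \<Longrightarrow> x \<in> units G1 \<Longrightarrow> t (f x) = Phi f (t x)"
    and t'_equiv: "f' \<in> Gam2 \<Longrightarrow> y \<in> units G2 \<Longrightarrow> t' (f' y) = Psi f' (t' y)"
    and Gam1_tfgs: "Gam1 \<subseteq> L.tfgs" and Gam2_tfgs: "Gam2 \<subseteq> R.tfgs"
    and Gam1_comp: "f \<in> Gam1 \<Longrightarrow> g \<in> Gam1 \<Longrightarrow> f \<circ> g \<in> Gam1"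
    and Gam2_comp: "f' \<in> Gam2 \<Longrightarrow> g' \<in> Gam2 \<Longrightarrow> f' \<circ> g' \<in> Gam2"
    and cover1: "k \<in> arrows G1 \<Longrightarrow> \<exists>f\<in>Gam1. L.germ f k"
    and cover2: "k' \<in> arrows G2 \<Longrightarrow> \<exists>f'\<in>Gam2. R.germ f' k'"
begin

lemma swap: "spatial_pair G2 G1 Gam2 Gam1 Psi Phi t' t"
proof
  show "homeomorphic_maps R.Y L.Y t' t" using maps by (subst homeomorphic_maps_sym)
qed (simp_all add: Phi_in Psi_in Psi_Phi Phi_Psi Phi_comp Psi_comp t_equiv t'_equiv
      Gam1_tfgs Gam2_tfgs Gam1_comp Gam2_comp cover1 cover2)

lemma t_units:
  assumes "x \<in> units G1"
  shows "t x \<in> units G2" "t' (t x) = x"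
  using maps assms continuous_map_image_subset_topspace[of L.Y R.Y t]
  unfolding homeomorphic_maps_def by auto

lemma t'_units:
  assumes "y \<in> units G2"
  shows "t' y \<in> units G1" "t (t' y) = y"
  using maps assms continuous_map_image_subset_topspace[of R.Y L.Y t']
  unfolding homeomorphic_maps_def by auto

lemma t_open: "openin L.Y V \<Longrightarrow> openin R.Y (t ` V)"
  using maps homeomorphic_map_openness_eq unfolding homeomorphic_maps_map by blast

text \<open>The germ of \<open>f\<close> at \<open>x\<close> corresponds to the germ of
  \<open>Phi f\<close> at \<open>t x\<close>. Many \<open>f\<close> share a germ, so independence of
  the choice is left to \<open>rel_unique\<close>.\<close>

definition rel :: "'a \<Rightarrow> 'b \<Rightarrow> bool" where
  "rel g h \<longleftrightarrow> (\<exists>f\<in>Gam1. L.germ f g \<and> R.germ (Phi f) h \<and> R.s h = t (L.s g))"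

lemma rel_if_swapped:
  assumes "spatial_pair.rel G2 G1 Gam2 Psi t' h g"
  shows "rel g h"
proof -
  obtain f where f: "f \<in> Gam2" "R.germ f h" "L.germ (Psi f) g" "L.s g = t' (R.s h)"
    using assms unfolding spatial_pair.rel_def[OF swap] by blast
  have "R.s h = t (L.s g)"
    using f(4) t'_units(2)[OF R.s_in[OF R.germ_A[OF f(2)]]] by simp
  then show ?thesis
    unfolding rel_def using f Psi_in[OF f(1)] Phi_Psi[OF f(1)] by auto
qed

lemma rel_swap: "spatial_pair.rel G2 G1 Gam2 Psi t' h g \<longleftrightarrow> rel g h"
  using rel_if_swapped spatial_pair.rel_if_swapped[OF swap] by blast

lemma rel_arrows: "rel g h \<Longrightarrow> g \<in> arrows G1 \<and> h \<in> arrows G2"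
  unfolding rel_def using L.germ_A R.germ_A by blast

lemma rel_ends:
  assumes "rel g h"
  shows "R.s h = t (L.s g)" "R.r h = t (L.r g)"
proof -
  obtain f where f: "f \<in> Gam1" "L.germ f g" "R.germ (Phi f) h" "R.s h = t (L.s g)"
    using assms unfolding rel_def by blast
  show "R.s h = t (L.s g)" by (rule f(4))
  show "R.r h = t (L.r g)"
    using R.germ_r[OF f(3)] L.germ_r[OF f(2)] t_equiv[OF f(1), of "L.s g"] L.s_in[OF L.germ_A[OF f(2)]] f(4)
    by metis
qed

text \<open>Two elements with the common germ \<open>g\<close> agree near its source. By
  equivariance of \<open>t\<close> their images under \<open>Phi\<close> agree near the image point,
  and there effectiveness leaves only one arrow.\<close>

lemma rel_unique:
  assumes "rel g h" "rel g h'"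
  shows "h = h'"
proof -
  obtain f where f: "f \<in> Gam1" "L.germ f g" "R.germ (Phi f) h" "R.s h = t (L.s g)"
    using assms(1) unfolding rel_def by blast
  obtain f' where f': "f' \<in> Gam1" "L.germ f' g" "R.germ (Phi f') h'" "R.s h' = t (L.s g)"
    using assms(2) unfolding rel_def by blast
  obtain W where W: "openin L.T W" "g \<in> W" "\<forall>k\<in>W. L.r k = f (L.s k)"
    using f(2) unfolding L.germ_def by blast
  obtain W' where W': "openin L.T W'" "g \<in> W'" "\<forall>k\<in>W'. L.r k = f' (L.s k)"
    using f'(2) unfolding L.germ_def by blast
  define V where "V = L.s ` (W \<inter> W')"
  have V: "openin L.Y V" unfolding V_def using W(1) W'(1) by (intro L.s_open openin_Int)
  have "Phi f y = Phi f' y" if y: "y \<in> t ` V" for y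
  proof -
    obtain k where k: "k \<in> W \<inter> W'" "y = t (L.s k)" using y by (auto simp: V_def)
    then have "k \<in> arrows G1" using openin_subset[OF W(1)] by auto
    then have u: "L.s k \<in> units G1" by (rule L.s_in)
    have "f (L.s k) = f' (L.s k)" using k W(3) W'(3) by auto
    then show ?thesis using t_equiv[OF f(1) u] t_equiv[OF f'(1) u] k(2) by simp
  qed
  moreover have "R.s h' \<in> t ` V" using f'(4) W(2) W'(2) by (auto simp: V_def)
  ultimately have "R.germ (Phi f) h'"
    using R.germ_cong[OF f'(3) t_open[OF V]] by blast
  moreover have "inj (Phi f)"
    using Phi_in[OF f(1)] Gam2_tfgs R.tfgs_bij bij_is_inj by blast
  ultimately show ?thesis
    using R.germ_unique f(3,4) f'(4) by metis
qed

lemma rel_total: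
  assumes "g \<in> arrows G1"
  shows "\<exists>h. rel g h"
proof -
  obtain f where f: "f \<in> Gam1" "L.germ f g" using cover1[OF assms] by blast
  have "Phi f \<in> R.tfgs" using Phi_in[OF f(1)] Gam2_tfgs by blast
  from R.tfgs_germ[OF this t_units(1)[OF L.s_in[OF assms]]]
  show ?thesis using f unfolding rel_def by blast
qed

definition tau :: "'a \<Rightarrow> 'b" where
  "tau g = (THE h. rel g h)"

lemma tau_eq: "rel g h \<Longrightarrow> tau g = h"
  unfolding tau_def by (rule the_equality) (auto intro: rel_unique)

lemma rel_tau: "g \<in> arrows G1 \<Longrightarrow> rel g (tau g)"
  using rel_total tau_eq by blast

text \<open>Over the arrows that are germs of a fixed \<open>f\<close>, the map is governed by
  sources: an open set of such arrows goes to the part of the bisection of \<open>Phi f\<close>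
  whose sources lie in the image under \<open>t\<close>, which is open.\<close>

lemma tau_open:
  assumes B: "openin L.T B"
  shows "openin R.T (tau ` B)"
proof (subst openin_subopen, intro ballI)
  fix h assume "h \<in> tau ` B"
  then obtain g where g: "g \<in> B" "h = tau g" by blast
  then have "rel g h" using rel_tau openin_subset[OF B] by auto
  then obtain f where f: "f \<in> Gam1" "L.germ f g" "R.germ (Phi f) h" "R.s h = t (L.s g)"
    unfolding rel_def by blast
  define B' where "B' = B \<inter> {g. L.germ f g}"
  have "openin R.Y (t ` L.s ` B')"
    unfolding B'_def by (intro t_open L.s_open openin_Int B L.germ_open)
  then have "openin R.T ({k. R.germ (Phi f) k} \<inter> {k \<in> topspace R.T. R.s k \<in> t ` L.s ` B'})"
    using R.germ_open openin_continuous_map_preimage[OF R.s_cont] by blast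
  moreover have "h \<in> {k. R.germ (Phi f) k} \<inter> {k \<in> topspace R.T. R.s k \<in> t ` L.s ` B'}"
    using f g R.germ_A[OF f(3)] by (auto simp: B'_def)
  moreover have "{k. R.germ (Phi f) k} \<inter> {k \<in> topspace R.T. R.s k \<in> t ` L.s ` B'} \<subseteq> tau ` B"
  proof
    fix k assume "k \<in> {k. R.germ (Phi f) k} \<inter> {k \<in> topspace R.T. R.s k \<in> t ` L.s ` B'}"
    then obtain g' where "R.germ (Phi f) k" "g' \<in> B'" "R.s k = t (L.s g')" by auto
    then have "rel g' k" "g' \<in> B" using f(1) by (auto simp: rel_def B'_def)
    then show "k \<in> tau ` B" using tau_eq by blast
  qed
  ultimately show "\<exists>V. openin R.T V \<and> h \<in> V \<and> V \<subseteq> tau ` B" by blast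
qed

theorem groupoid_isomorphic: "groupoid_isomorphic G1 G2"
proof -
  interpret S: spatial_pair G2 G1 Gam2 Gam1 Psi Phi t' t by (rule swap)
  have inv: "S.tau (tau g) = g" if "g \<in> arrows G1" for g
    using rel_tau[OF that] by (intro S.tau_eq) (simp add: rel_swap)
  have inv': "tau (S.tau h) = h" if "h \<in> arrows G2" for h
    using S.rel_tau[OF that] by (intro tau_eq) (simp add: rel_swap)
  have "homeomorphic_maps L.T R.T tau S.tau"
    by (rule homeomorphic_maps_if_open)
      (use inv inv' rel_arrows[OF rel_tau] S.rel_arrows[OF S.rel_tau] tau_open S.tau_open in auto)
  then have "homeomorphic_map L.T R.T tau"
    by (simp add: homeomorphic_maps_map)
  moreover have comp: "gcomp G1 g h \<longleftrightarrow> gcomp G2 (tau g) (tau h)" if "g \<in> arrows G1" "h \<in> arrows G1" for g h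
  proof -
    note gh = rel_tau[OF that(1)] rel_tau[OF that(2)]
    have "L.s g = L.r h \<longleftrightarrow> t (L.s g) = t (L.r h)"
      using t_units(2) L.s_in[OF that(1)] L.r_in[OF that(2)] by metis
    then show ?thesis
      using that rel_arrows[OF gh(1)] rel_arrows[OF gh(2)] rel_ends[OF gh(1)] rel_ends[OF gh(2)]
      by (simp add: L.c_iff R.c_iff)
  qed
  moreover have "tau (gmul G1 g h) = gmul G2 (tau g) (tau h)" if c: "gcomp G1 g h" for g h
  proof (rule tau_eq)
    have gh: "g \<in> arrows G1" "h \<in> arrows G1" "L.s g = L.r h" using c by (auto simp: L.c_iff)
    have c': "gcomp G2 (tau g) (tau h)" using comp gh c by blast
    then have gh': "tau g \<in> arrows G2" "tau h \<in> arrows G2" "R.s (tau g) = R.r (tau h)" by (auto simp: R.c_iff)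
    obtain f where f: "f \<in> Gam1" "L.germ f g" "R.germ (Phi f) (tau g)"
      using rel_tau[OF gh(1)] unfolding rel_def by blast
    obtain f' where f': "f' \<in> Gam1" "L.germ f' h" "R.germ (Phi f') (tau h)"
      using rel_tau[OF gh(2)] unfolding rel_def by blast
    have "L.germ (f \<circ> f') (gmul G1 g h)" "R.germ (Phi (f \<circ> f')) (gmul G2 (tau g) (tau h))"
      using L.germ_comp[OF f(2) f'(2) gh(3)] R.germ_comp[OF f(3) f'(3) gh'(3)] Phi_comp[OF f(1) f'(1)] by simp_all
    moreover have "R.s (gmul G2 (tau g) (tau h)) = t (L.s (gmul G1 g h))"
      using L.s_m[OF gh] R.s_m[OF gh'] rel_ends(1)[OF rel_tau[OF gh(2)]] by simp
    ultimately show "rel (gmul G1 g h) (gmul G2 (tau g) (tau h))"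
      unfolding rel_def using Gam1_comp[OF f(1) f'(1)] by blast
  qed
  ultimately show ?thesis
    unfolding groupoid_isomorphic_def groupoid_iso_map_def by blast
qed

end

theorem groupoid_isomorphic_if_subgroups_isomorphic:
  assumes G1: "min_ample_gpd G1" and G2: "min_ample_gpd G2"
    and sub1: "subgroup Gam1 (tfg G1)" "carrier (Dtfg G1) \<subseteq> Gam1"
    and sub2: "subgroup Gam2 (tfg G2)" "carrier (Dtfg G2) \<subseteq> Gam2"
    and iso: "(tfg G1)\<lparr>carrier := Gam1\<rparr> \<cong> (tfg G2)\<lparr>carrier := Gam2\<rparr>"
  shows "groupoid_isomorphic G1 G2"
proof -
  interpret L: min_ample_gpd G1 by (rule G1)
  interpret R: min_ample_gpd G2 by (rule G2)
  have D1: "derived (tfg G1) (carrier (tfg G1)) \<subseteq> Gam1" and D2: "derived (tfg G2) (carrier (tfg G2)) \<subseteq> Gam2"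
    using sub1(2) sub2(2) by (simp_all add: Dtfg_def)
  interpret A: homeo_group L.Y Gam1 by (rule L.homeo_group_if_derived_subset[OF sub1(1) D1])
  interpret B: homeo_group R.Y Gam2 by (rule R.homeo_group_if_derived_subset[OF sub2(1) D2])
  obtain Phi where Phi: "Phi \<in> iso ((tfg G1)\<lparr>carrier := Gam1\<rparr>) ((tfg G2)\<lparr>carrier := Gam2\<rparr>)"
    using iso unfolding is_iso_def by blast
  then have bij: "bij_betw Phi Gam1 Gam2"
    by (simp add: iso_def)
  from Phi have Phi_comp: "Phi (f \<circ> g) = Phi f \<circ> Phi g" if "f \<in> Gam1" "g \<in> Gam1" for f g
    using that by (simp add: iso_def hom_def)
  define Psi where "Psi = inv_into Gam1 Phi"
  have Phi_in: "Phi f \<in> Gam2" if "f \<in> Gam1" for f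
    using bij that by (auto simp: bij_betw_def)
  have Psi_in: "Psi f \<in> Gam1" if "f \<in> Gam2" for f
    using bij that unfolding Psi_def bij_betw_def by (metis inv_into_into)
  have Psi_Phi: "Psi (Phi f) = f" if "f \<in> Gam1" for f
    using bij that unfolding Psi_def by (rule bij_betw_inv_into_left)
  have Phi_Psi: "Phi (Psi f) = f" if "f \<in> Gam2" for f
    using bij that unfolding Psi_def by (rule bij_betw_inv_into_right)
  have Psi_comp: "Psi (f \<circ> g) = Psi f \<circ> Psi g" if "f \<in> Gam2" "g \<in> Gam2" for f g
    using Phi_comp[OF Psi_in[OF that(1)] Psi_in[OF that(2)]] Phi_Psi that
      Psi_Phi[OF A.comp_in[OF Psi_in[OF that(1)] Psi_in[OF that(2)]]] by simp
  interpret homeo_group_iso L.Y Gam1 R.Y Gam2 Phi Psi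
    by unfold_locales (simp_all add: Phi_in Psi_in Psi_Phi Phi_Psi Phi_comp Psi_comp)
  obtain t t' where t: "homeomorphic_maps L.Y R.Y t t'"
    "\<And>f x. f \<in> Gam1 \<Longrightarrow> x \<in> topspace L.Y \<Longrightarrow> t (f x) = Phi f (t x)"
    "\<And>f y. f \<in> Gam2 \<Longrightarrow> y \<in> topspace R.Y \<Longrightarrow> t' (f y) = Psi f (t' y)"
    using spatial_realization by blast
  have "spatial_pair G1 G2 Gam1 Gam2 Phi Psi t t'"
  proof
    show "Gam1 \<subseteq> L.tfgs" using subgroup.subset[OF sub1(1)] by (simp add: L.carrier_tfg)
    show "Gam2 \<subseteq> R.tfgs" using subgroup.subset[OF sub2(1)] by (simp add: R.carrier_tfg)
    show "\<exists>f\<in>Gam1. L.germ f k" if "k \<in> arrows G1" for k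
      by (rule L.realized_in[OF D1 A.comp_in that])
    show "\<exists>f\<in>Gam2. R.germ f k" if "k \<in> arrows G2" for k
      by (rule R.realized_in[OF D2 B.comp_in that])
  qed (use t in \<open>simp_all add: Phi_in Psi_in Psi_Phi Phi_Psi Phi_comp Psi_comp A.comp_in B.comp_in\<close>)
  then show ?thesis by (rule spatial_pair.groupoid_isomorphic)
qed

section \<open>Groupoid isomorphisms induce isomorphisms of full groups\<close>

locale gpd_iso = L: ample_gpd G1 + R: ample_gpd G2
  for G1 :: "'a tgpd" and G2 :: "'b tgpd" +
  fixes p :: "'a \<Rightarrow> 'b" and q :: "'b \<Rightarrow> 'a"
  assumes maps: "homeomorphic_maps (gtop G1) (gtop G2) p q"
    and p_comp: "g \<in> arrows G1 \<Longrightarrow> h \<in> arrows G1 \<Longrightarrow> gcomp G1 g h \<longleftrightarrow> gcomp G2 (p g) (p h)"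
    and p_mult: "gcomp G1 g h \<Longrightarrow> p (gmul G1 g h) = gmul G2 (p g) (p h)"
begin

lemma p_in:
  assumes "g \<in> arrows G1"
  shows "p g \<in> arrows G2" "q (p g) = g"
  using maps assms continuous_map_image_subset_topspace[of L.T R.T p]
  unfolding homeomorphic_maps_def by auto

lemma q_in:
  assumes "h \<in> arrows G2"
  shows "q h \<in> arrows G1" "p (q h) = h"
  using maps assms continuous_map_image_subset_topspace[of R.T L.T q]
  unfolding homeomorphic_maps_def by auto

lemma swap: "gpd_iso G2 G1 q p"
proof
  show "homeomorphic_maps R.T L.T q p" using maps by (subst homeomorphic_maps_sym)
  show comp: "gcomp G2 g h \<longleftrightarrow> gcomp G1 (q g) (q h)" if "g \<in> arrows G2" "h \<in> arrows G2" for g h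
    using p_comp[OF q_in(1) q_in(1), OF that] q_in(2) that by simp
  show "q (gmul G2 g h) = gmul G1 (q g) (q h)" if "gcomp G2 g h" for g h
  proof -
    have A: "g \<in> arrows G2" "h \<in> arrows G2" using that by (auto simp: R.c_iff)
    then have c: "gcomp G1 (q g) (q h)" using comp that by blast
    then have "gmul G2 g h = p (gmul G1 (q g) (q h))"
      using p_mult q_in(2) A by simp
    then show ?thesis using p_in(2) L.c_in(3)[OF c] by simp
  qed
qed

lemma p_unit:
  assumes "x \<in> units G1"
  shows "p x \<in> units G2"
proof -
  have "gcomp G1 x x" "gmul G1 x x = x"
    using L.m_r[OF L.units_A[OF assms]] L.r_unit[OF assms] by auto
  then show ?thesis
    using p_mult[of x x] p_comp[of x x] L.units_A[OF assms] by (intro R.unit_if_idem) auto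
qed

lemma p_s:
  assumes "g \<in> arrows G1"
  shows "R.s (p g) = p (L.s g)"
proof -
  have u: "L.s g \<in> units G1" by (rule L.s_in[OF assms])
  have "gcomp G2 (p g) (p (L.s g))"
    using L.m_s[OF assms] p_comp[OF assms L.units_A[OF u]] by blast
  then show ?thesis using R.r_unit[OF p_unit[OF u]] by (simp add: R.c_iff)
qed

lemma p_r:
  assumes "g \<in> arrows G1"
  shows "R.r (p g) = p (L.r g)"
proof -
  have u: "L.r g \<in> units G1" by (rule L.r_in[OF assms])
  have "gcomp G2 (p (L.r g)) (p g)"
    using L.m_r[OF assms] p_comp[OF L.units_A[OF u] assms] by blast
  then show ?thesis using R.s_unit[OF p_unit[OF u]] by (simp add: R.c_iff)
qed

text \<open>Conjugation by \<open>p\<close>, extended by the identity off the units as in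
  \<open>pi_bis\<close>; thus the transports along \<open>p\<close> and \<open>q\<close> are inverse
  to each other as plain functions on the two full groups.\<close>

definition transport :: "('a \<Rightarrow> 'a) \<Rightarrow> 'b \<Rightarrow> 'b" where
  "transport f y = (if y \<in> units G2 then p (f (q y)) else y)"

lemma q_unit: "y \<in> units G2 \<Longrightarrow> q y \<in> units G1"
  by (rule gpd_iso.p_unit[OF swap])

lemma transport_comp:
  assumes "g \<in> L.tfgs"
  shows "transport (f \<circ> g) = transport f \<circ> transport g"
proof
  fix y
  show "transport (f \<circ> g) y = (transport f \<circ> transport g) y"
    using L.tfgs_maps[OF assms q_unit[of y]] p_unit p_in(2) L.units_A by (auto simp: transport_def)
qed

lemma transport_id: "transport id = id"
  using q_in(2) R.units_A by (auto simp: transport_def)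

text \<open>The isomorphism intertwines sources and ranges, so it carries a neighbourhood witnessing
  the germ to one for the conjugate; membership in the other full group follows arrow by
  arrow.\<close>

lemma transport_germ:
  assumes "L.germ f g"
  shows "R.germ (transport f) (p g)"
proof -
  obtain W where W: "openin L.T W" "g \<in> W" "\<forall>h\<in>W. L.r h = f (L.s h)"
    using assms unfolding L.germ_def by blast
  have "openin R.T (p ` W)"
    using maps homeomorphic_map_openness_eq W(1) unfolding homeomorphic_maps_map by blast
  moreover have "R.r h = transport f (R.s h)" if h: "h \<in> p ` W" for h
  proof -
    obtain k where k: "k \<in> W" "h = p k" using h by blast
    then have kA: "k \<in> arrows G1" using openin_subset[OF W(1)] by auto
    then show ?thesis
      using k W(3) p_s p_r p_unit[OF L.s_in[OF kA]] p_in(2)[OF L.units_A[OF L.s_in[OF kA]]]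
      by (simp add: transport_def)
  qed
  ultimately show ?thesis unfolding R.germ_def using W(2) by blast
qed

lemma transport_in:
  assumes f: "f \<in> L.tfgs"
  shows "transport f \<in> R.tfgs"
proof -
  have b: "bij f" by (rule L.tfgs_bij[OF f])
  have "f \<circ> fun_inv f = id" "fun_inv f \<circ> f = id"
    using bij_inv_simps(1,2)[OF b] by (simp_all add: fun_eq_iff)
  then have "transport f \<circ> transport (fun_inv f) = id" "transport (fun_inv f) \<circ> transport f = id"
    using transport_comp[OF f, of "fun_inv f"] transport_comp[OF L.tfgs_inv[OF f], of f] transport_id by simp_all
  then have "bij (transport f)" by (metis o_bij)
  moreover have "\<exists>C. compactin R.Y C \<and> moved (transport f) \<subseteq> C"
  proof -
    obtain C where C: "compactin L.Y C" "moved f \<subseteq> C" using f unfolding L.tfgs_def by blast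
    have CT: "compactin L.T C" "C \<subseteq> units G1"
      using C(1) by (simp_all add: unit_top_def compactin_subtopology)
    have "continuous_map L.T R.T p" using maps by (simp add: homeomorphic_maps_def)
    then have "compactin R.T (p ` C)" by (rule image_compactin[OF CT(1)])
    moreover have "p ` C \<subseteq> units G2" using CT(2) p_unit by blast
    ultimately have "compactin R.Y (p ` C)" by (simp add: unit_top_def compactin_subtopology)
    moreover have "moved (transport f) \<subseteq> p ` C"
    proof
      fix y assume "y \<in> moved (transport f)"
      then have y: "y \<in> units G2" "p (f (q y)) \<noteq> y"
        by (auto simp: moved_def transport_def split: if_splits)
      then have "y = p (q y)" using q_in(2) R.units_A by simp
      moreover have "q y \<in> moved f" using y calculation by (auto simp: moved_def)
      ultimately show "y \<in> p ` C" using C(2) by blast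
    qed
    ultimately show ?thesis by blast
  qed
  moreover have "\<exists>k. R.germ (transport f) k \<and> R.s k = y" if y: "y \<in> units G2" for y
  proof -
    obtain g where g: "L.germ f g" "L.s g = q y" using L.tfgs_germ[OF f q_unit[OF y]] by blast
    then have "R.s (p g) = y" using p_s[OF L.germ_A[OF g(1)]] q_in(2)[OF R.units_A[OF y]] by simp
    then show ?thesis using transport_germ[OF g(1)] by blast
  qed
  ultimately show ?thesis unfolding R.tfgs_def by blast
qed

lemma transport_swap:
  assumes "f \<in> L.tfgs"
  shows "gpd_iso.transport G1 q p (transport f) = f"
proof
  fix x
  show "gpd_iso.transport G1 q p (transport f) x = f x"
    unfolding gpd_iso.transport_def[OF swap] transport_def
    using p_unit[of x] p_in(2)[OF L.units_A, of x] p_in(2)[OF L.units_A[OF L.tfgs_maps[OF assms]], of x]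
      L.tfgs_moved[OF assms] not_moved[of x f] by auto
qed

theorem tfg_iso: "tfg G1 \<cong> tfg G2"
proof -
  interpret S: gpd_iso G2 G1 q p by (rule swap)
  have "bij_betw transport L.tfgs R.tfgs"
    by (rule bij_betwI[where g = S.transport])
      (use transport_in S.transport_in transport_swap S.transport_swap in auto)
  moreover have "transport \<in> hom (tfg G1) (tfg G2)"
    using transport_in transport_comp by (auto simp: hom_def L.carrier_tfg R.carrier_tfg)
  ultimately show ?thesis
    unfolding is_iso_def iso_def by (auto simp: L.carrier_tfg R.carrier_tfg)
qed

end

lemma tfg_iso_if_groupoid_isomorphic:
  assumes "ample_gpd G1" "ample_gpd G2" "groupoid_isomorphic G1 G2"
  shows "tfg G1 \<cong> tfg G2"
proof -
  obtain p where p: "groupoid_iso_map G1 G2 p"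
    using assms(3) unfolding groupoid_isomorphic_def by blast
  then obtain q where "homeomorphic_maps (gtop G1) (gtop G2) p q"
    unfolding groupoid_iso_map_def homeomorphic_map_maps by blast
  then have "gpd_iso G1 G2 p q"
    using p assms(1,2) unfolding gpd_iso_def gpd_iso_axioms_def groupoid_iso_map_def by blast
  then show ?thesis by (rule gpd_iso.tfg_iso)
qed

lemma derived_subgroup_iso:
  assumes "group G" "group H" "G \<cong> H"
  shows "G\<lparr>carrier := derived G (carrier G)\<rparr> \<cong> H\<lparr>carrier := derived H (carrier H)\<rparr>"
proof -
  interpret G: group G by fact
  interpret H: group H by fact
  obtain h where h: "h \<in> hom G H" "bij_betw h (carrier G) (carrier H)"
    using assms(3) by (auto simp: is_iso_def iso_def)
  interpret group_hom G H h
    using h(1) by unfold_locales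
  have sub: "derived G (carrier G) \<subseteq> carrier G" by (rule G.derived_in_carrier) simp
  have "h ` carrier G = carrier H" using h(2) by (simp add: bij_betw_def)
  then have img: "h ` derived G (carrier G) = derived H (carrier H)"
    using derived_img[of "carrier G"] by simp
  then have "bij_betw h (derived G (carrier G)) (derived H (carrier H))"
    using h(2) sub by (auto simp: bij_betw_def intro: inj_on_subset)
  moreover have "h \<in> hom (G\<lparr>carrier := derived G (carrier G)\<rparr>) (H\<lparr>carrier := derived H (carrier H)\<rparr>)"
    using img sub by (auto simp: hom_def subset_iff)
  ultimately show ?thesis unfolding is_iso_def iso_def by auto
qed

theorem theorem7p2:
  fixes G1 :: "'a tgpd" and G2 :: "'b tgpd"
  assumes "ample G1" "effective G1" "minimal G1" "hausdorff_groupoid G1" "no_isolated_units G1"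
      and "ample G2" "effective G2" "minimal G2" "hausdorff_groupoid G2" "no_isolated_units G2"
  shows "(\<forall>\<Gamma>1 \<Gamma>2. subgroup \<Gamma>1 (tfg G1) \<and> carrier (Dtfg G1) \<subseteq> \<Gamma>1 \<and>
                  subgroup \<Gamma>2 (tfg G2) \<and> carrier (Dtfg G2) \<subseteq> \<Gamma>2 \<and>
                  (tfg G1)\<lparr>carrier := \<Gamma>1\<rparr> \<cong> (tfg G2)\<lparr>carrier := \<Gamma>2\<rparr>
                  \<longrightarrow> groupoid_isomorphic G1 G2)
       \<and> (groupoid_isomorphic G1 G2 \<longleftrightarrow> tfg G1 \<cong> tfg G2)
       \<and> (tfg G1 \<cong> tfg G2 \<longleftrightarrow> Dtfg G1 \<cong> Dtfg G2)"
proof -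
  have m1: "min_ample_gpd G1" and m2: "min_ample_gpd G2"
    using assms by unfold_locales
  interpret L: min_ample_gpd G1 by (rule m1)
  interpret R: min_ample_gpd G2 by (rule m2)
  note main = groupoid_isomorphic_if_subgroups_isomorphic[OF m1 m2]
  note gl = L.group_tfg and gr = R.group_tfg
  have D1: "subgroup (carrier (Dtfg G1)) (tfg G1)" and D2: "subgroup (carrier (Dtfg G2)) (tfg G2)"
    using group.derived_is_subgroup[OF gl] group.derived_is_subgroup[OF gr] by (simp_all add: Dtfg_def)
  have sub: "carrier (Dtfg G1) \<subseteq> carrier (tfg G1)" "carrier (Dtfg G2) \<subseteq> carrier (tfg G2)"
    using subgroup.subset[OF D1] subgroup.subset[OF D2] .
  have to_tfg: "tfg G1 \<cong> tfg G2" if "groupoid_isomorphic G1 G2"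
    using tfg_iso_if_groupoid_isomorphic[OF L.ample_gpd_axioms R.ample_gpd_axioms that] .
  \<comment> \<open>Both extreme intermediate subgroups are admissible: the whole full group here,
    the commutator subgroup in the next step.\<close>
  have from_tfg: "groupoid_isomorphic G1 G2" if "tfg G1 \<cong> tfg G2"
    using that by (intro main[of "carrier (tfg G1)" "carrier (tfg G2)"] group.subgroup_self gl gr sub) simp
  have from_D: "groupoid_isomorphic G1 G2" if "Dtfg G1 \<cong> Dtfg G2"
    using that by (intro main[OF D1 _ D2]) (simp_all add: Dtfg_def)
  have to_D: "Dtfg G1 \<cong> Dtfg G2" if "tfg G1 \<cong> tfg G2"
    unfolding Dtfg_def by (rule derived_subgroup_iso[OF gl gr that])
  show ?thesis
    using main to_tfg from_tfg from_D to_D by blast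
qed

end
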